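(* Let $\mathbf{d}\in\mathbb{R}^d$, let $\lambda>0$ be a regularization coefficient, and consider learning the symmetric two-component Gaussian mixture $\mathbf{X}\sim\frac12\mathcal{N}(\boldsymbol{\mu}_{\mathbf{X}},\Sigma_{\mathbf{X}})+\frac12\mathcal{N}(-\boldsymbol{\mu}_{\mathbf{X}},\Sigma_{\mathbf{X}})$ in $\mathbb{R}^d$ through the minimax problem $\min_{\Lambda,\boldsymbol{\mu}}\mathcal{L}(G_{\Lambda,\boldsymbol{\mu}})$ over $\Lambda\in\mathbb{R}^{d\times d}$, $\boldsymbol{\mu}\in\mathbb{R}^d$, where $$\mathcal{L}(G_{\Lambda,\boldsymbol{\mu}})=\max_{A,(\mathbf{b}_i)_{i=1}^4}\ \mathbb{E}\bigl[D_{A,(\mathbf{b}_i)}(\mathbf{X})\bigr]-\mathbb{E}\bigl[D_{A,(\mathbf{b}_i)}(G_{\Lambda,\boldsymbol{\mu}}(\mathbf{Z}))\bigr]-\frac{\lambda}{2}\Bigl(\Vert A\Vert_F^2+\Vert\mathbf{b}_1-\mathbf{d}\Vert_2^2+\Vert\mathbf{b}_2+\mathbf{d}\Vert_2^2+\Vert\mathbf{b}_3-\mathbf{d}\Vert_2^2+\Vert\mathbf{b}_4+\mathbf{d}\Vert_2^2\Bigr).$$ Suppose that $(\boldsymbol{\mu}_{\mathbf{X}},\Sigma_{\mathbf{X}})$ satisfies the separability condition (defined in the context) along the vector $\mathbf{d}$. Then $(\boldsymbol{\mu},\Sigma)=(\boldsymbol{\mu}_{\mathbf{X}},\Sigma_{\mathbf{X}})$,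 where $\Sigma=\Lambda\Lambda^T$, is the only minimizer of $\mathcal{L}(G_{\Lambda,\boldsymbol{\mu}})$ satisfying the separability condition along $\mathbf{d}$.
   Context: Separability condition: mean and covariance parameters $(\boldsymbol{\mu},\Sigma)$ satisfy it along a vector $\widetilde{\mathbf{d}}$ if $$2\widetilde{\mathbf{d}}^T\Sigma\widetilde{\mathbf{d}}+\sqrt{\widetilde{\mathbf{d}}^T\Sigma\widetilde{\mathbf{d}}}\le\bigl|\boldsymbol{\mu}^T\widetilde{\mathbf{d}}\bigr|.$$ The generator is the random map $G_{\Lambda,\boldsymbol{\mu}}(\mathbf{z})=Y(\Lambda\mathbf{z}+\boldsymbol{\mu})$ with $Y$ uniform on $\{-1,+1\}$, independent of $\mathbf{Z}\sim\mathcal{N}(\mathbf{0},I_{d\times d})$. The discriminator is $$D_{A,(\mathbf{b}_i)_{i=1}^4}(\mathbf{x})=\frac12\mathbf{x}^TA\mathbf{x}+\log\biggl(\frac{\exp(\mathbf{b}_1^T\mathbf{x})+\exp(\mathbf{b}_2^T\mathbf{x})}{\exp(\mathbf{b}_3^T\mathbf{x})+\exp(\mathbf{b}_4^T\mathbf{x})}\biggr),$$ with $A\in\mathbb{R}^{d\times d}$ and $\mathbf{b}_i\in\mathbb{R}^d$. $\Vert\cdot\Vert_F$ is the Frobenius norm.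
   Formalization: Uniqueness is stated up to the sign of μ, since (−μ_X, Σ_X) is also a separable minimizer, and only when μ_X^T d ≠ 0; it fails, for instance, for d = 0, X = ±1, λ ≥ 1/2, where N(0,1) is another separable minimizer. *)

theory Defs
  imports "HOL-Probability.Probability"
begin

definition std_gaussian :: "(real ^ 'n) measure" where
  "std_gaussian = density lborel (\<lambda>z. ennreal (\<Prod>i\<in>UNIV. std_normal_density (z $ i)))"

text \<open>
  The law \<open>N(\<mu>, \<Sigma>)\<close> is that of \<open>S Z + \<mu>\<close> with \<open>Z\<close> standard Gaussian and \<open>S S\<^sup>T = \<Sigma>\<close>.
  So \<open>\<Sigma>\<close> is symmetric positive semidefinite, possibly singular (there need not be a density);
  by rotation invariance the law does not depend on the choice of \<open>S\<close>.
\<close>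

definition gaussian_law :: "(real ^ 'n) measure \<Rightarrow> real ^ 'n \<Rightarrow> real ^ 'n ^ 'n \<Rightarrow> bool" where
  "gaussian_law N \<mu> \<Sigma> \<longleftrightarrow>
     (\<exists>S :: real ^ 'n ^ 'n. S ** transpose S = \<Sigma> \<and>
        N = distr std_gaussian borel (\<lambda>z. S *v z + \<mu>))"

definition symmetric_mixture_law ::
    "(real ^ 'n) measure \<Rightarrow> real ^ 'n \<Rightarrow> real ^ 'n ^ 'n \<Rightarrow> bool" where
  "symmetric_mixture_law P \<mu> \<Sigma> \<longleftrightarrow>
     (\<exists>N1 N2. gaussian_law N1 \<mu> \<Sigma> \<and> gaussian_law N2 (- \<mu>) \<Sigma> \<and>
        sets P = sets borel \<and>
        (\<forall>B\<in>sets borel. measure P B = 1/2 * measure N1 B + 1/2 * measure N2 B))"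

definition separability :: "real ^ 'n \<Rightarrow> real ^ 'n \<Rightarrow> real ^ 'n ^ 'n \<Rightarrow> bool" where
  "separability d \<mu> \<Sigma> \<longleftrightarrow>
     2 * (d \<bullet> (\<Sigma> *v d)) + sqrt (d \<bullet> (\<Sigma> *v d)) \<le> \<bar>\<mu> \<bullet> d\<bar>"

definition generator :: "real ^ 'n ^ 'n \<Rightarrow> real ^ 'n \<Rightarrow> real \<Rightarrow> real ^ 'n \<Rightarrow> real ^ 'n" where
  "generator \<Lambda> \<mu> y z = y *\<^sub>R (\<Lambda> *v z + \<mu>)"

definition discriminator ::
    "real ^ 'n ^ 'n \<Rightarrow> real ^ 'n \<Rightarrow> real ^ 'n \<Rightarrow> real ^ 'n \<Rightarrow> real ^ 'n \<Rightarrow> real ^ 'n \<Rightarrow> real" where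
  "discriminator A b1 b2 b3 b4 x =
     1/2 * (x \<bullet> (A *v x)) +
     ln ((exp (b1 \<bullet> x) + exp (b2 \<bullet> x)) / (exp (b3 \<bullet> x) + exp (b4 \<bullet> x)))"

text \<open>
  The norm on \<^typ>\<open>real ^ 'n ^ 'n\<close> is the Euclidean norm of all entries, i.e. the Frobenius norm.
\<close>

definition minimax_objective ::
    "'a measure \<Rightarrow> ('a \<Rightarrow> real ^ 'n) \<Rightarrow> ('a \<Rightarrow> real) \<Rightarrow> ('a \<Rightarrow> real ^ 'n) \<Rightarrow> real \<Rightarrow> real ^ 'n \<Rightarrow>
     real ^ 'n ^ 'n \<Rightarrow> real ^ 'n \<Rightarrow>
     real ^ 'n ^ 'n \<Rightarrow> real ^ 'n \<Rightarrow> real ^ 'n \<Rightarrow> real ^ 'n \<Rightarrow> real ^ 'n \<Rightarrow> real" where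
  "minimax_objective M X Y Z lam d \<Lambda> \<mu> A b1 b2 b3 b4 =
     (\<integral>\<omega>. discriminator A b1 b2 b3 b4 (X \<omega>) \<partial>M)
     - (\<integral>\<omega>. discriminator A b1 b2 b3 b4 (generator \<Lambda> \<mu> (Y \<omega>) (Z \<omega>)) \<partial>M)
     - lam / 2 * ((norm A)\<^sup>2 + (norm (b1 - d))\<^sup>2 + (norm (b2 + d))\<^sup>2
                  + (norm (b3 - d))\<^sup>2 + (norm (b4 + d))\<^sup>2)"

text \<open>
  The supremum over all discriminators. It is taken in the extended reals so that no boundedness
  side condition is hidden; for \<open>lam > 0\<close> it is a maximum, since the objective is continuous and
  tends to \<open>-\<infinity>\<close> as the parameters grow.
\<close>

definition generator_loss ::
    "'a measure \<Rightarrow> ('a \<Rightarrow> real ^ 'n) \<Rightarrow> ('a \<Rightarrow> real) \<Rightarrow> ('a \<Rightarrow> real ^ 'n) \<Rightarrow> real \<Rightarrow> real ^ 'n \<Rightarrow>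
     real ^ 'n ^ 'n \<Rightarrow> real ^ 'n \<Rightarrow> ereal" where
  "generator_loss M X Y Z lam d \<Lambda> \<mu> =
     (SUP A. SUP b1. SUP b2. SUP b3. SUP b4.
        ereal (minimax_objective M X Y Z lam d \<Lambda> \<mu> A b1 b2 b3 b4))"

definition loss_minimizer ::
    "'a measure \<Rightarrow> ('a \<Rightarrow> real ^ 'n) \<Rightarrow> ('a \<Rightarrow> real) \<Rightarrow> ('a \<Rightarrow> real ^ 'n) \<Rightarrow> real \<Rightarrow> real ^ 'n \<Rightarrow>
     real ^ 'n ^ 'n \<Rightarrow> real ^ 'n \<Rightarrow> bool" where
  "loss_minimizer M X Y Z lam d \<Lambda> \<mu> \<longleftrightarrow>
     is_arg_min (\<lambda>(\<Lambda>', \<mu>'). generator_loss M X Y Z lam d \<Lambda>' \<mu>') (\<lambda>_. True) (\<Lambda>, \<mu>)"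

end

theory Submission
  imports Defs
begin

text \<open>
  The loss is nonnegative, as the reference discriminator \<open>A = 0\<close>, \<open>b = (d, -d, d, -d)\<close> has
  objective \<open>0\<close>, and it vanishes when the generator has the law of \<open>X\<close>. At any other zero of the
  loss the reference discriminator is optimal. First-order optimality in \<open>A\<close> along \<open>v v\<^sup>T\<close> and in
  \<open>(b\<^sub>1, b\<^sub>2)\<close> along \<open>(v, -v)\<close> says that \<open>E (v \<bullet> W)\<^sup>2\<close> and \<open>E (v \<bullet> W) tanh (d \<bullet> W)\<close>, with
  \<open>W \<sim> N(\<mu>, \<Sigma>)\<close>, agree for the two parameter pairs.
  For \<open>v = d\<close> this concerns the scalar \<open>w = d \<bullet> W \<sim> N(m, s\<^sup>2)\<close>. On the circle
  \<open>m = r cos \<theta>\<close>, \<open>s = r sin \<theta>\<close> the mean of \<open>w tanh w\<close> strictly decreases in \<open>\<theta>\<close>, by a single-crossing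
  argument, so \<open>m\<close> and \<open>s\<close> agree up to the sign of \<open>m\<close>. Then \<open>\<Sigma> d\<close> is an affine function of \<open>\<mu>\<close>, and
  \<open>E W tanh (d \<bullet> W) = \<mu> E tanh w + \<Sigma> d E (w - m) tanh w / s\<^sup>2\<close> becomes affine in \<open>\<mu>\<close>; the same crossing
  argument shows that its slope is nonzero, which gives \<open>\<mu>\<close>, and then the second moments give \<open>\<Sigma>\<close>.
\<close>

subsection \<open>Invariance of the standard Gaussian\<close>

lemma nn_integral_lborel_add_left:
  fixes a :: "'a::euclidean_space"
  assumes [measurable]: "g \<in> borel_measurable borel"
  shows "(\<integral>\<^sup>+x. g (a + x) \<partial>lborel) = (\<integral>\<^sup>+x. g x \<partial>lborel)"
proof -
  have "(\<integral>\<^sup>+x. g x \<partial>lborel) = (\<integral>\<^sup>+x. g x \<partial>distr lborel borel ((+) a))"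
    by (simp add: lborel_distr_plus)
  also have "\<dots> = (\<integral>\<^sup>+x. g (a + x) \<partial>lborel)"
    by (subst nn_integral_distr) simp_all
  finally show ?thesis by simp
qed

text \<open>A smoothing argument instead of a determinant. Integrate
  \<open>indicator B y * g (y + f x)\<close> over x and y. Since
  \<open>y + f x = f (inv f y + x)\<close>, translation invariance in x turns this into the volume
  of \<open>B\<close> times the integral of \<open>g (f x)\<close>. Shifting y by \<open>f x\<close>
  first and using that \<open>f\<close> is an isometry turns it into the same volume times the
  integral of \<open>g\<close>. The volume is positive and finite, so it cancels.\<close>

lemma nn_integral_lborel_orthogonal_transformation:
  fixes f :: "'a::euclidean_space \<Rightarrow> 'a"
  assumes f: "orthogonal_transformation f" and [measurable]: "g \<in> borel_measurable borel"
  shows "(\<integral>\<^sup>+x. g (f x) \<partial>lborel) = (\<integral>\<^sup>+x. g x \<partial>lborel)"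
proof -
  define B where "B = ball (0::'a) 1"
  have "linear f"
    using f by (rule orthogonal_transformation_linear)
  then have [measurable]: "f \<in> borel_measurable borel"
    by (simp add: borel_measurable_continuous_onI linear_continuous_on linear_linear)
  have [measurable]: "B \<in> sets borel"
    by (simp add: B_def)
  have finv: "f (inv f y) = y" for y
    using f by (simp add: orthogonal_transformation_surj surj_f_inv_f)
  have shift_f: "(\<integral>\<^sup>+x. g (y + f x) \<partial>lborel) = (\<integral>\<^sup>+x. g (f x) \<partial>lborel)" for y
    using nn_integral_lborel_add_left[of "\<lambda>x. g (f x)" "inv f y"] \<open>linear f\<close>
    by (simp add: linear_add finv)
  have ball_f: "(\<integral>\<^sup>+x. indicator B (y - f x) \<partial>lborel) = emeasure lborel B" for y
  proof -
    have "norm (y - f x) = norm (f (inv f y - x))" for x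
      by (simp add: linear_diff[OF \<open>linear f\<close>] finv)
    then have "norm (y - f x) = dist (inv f y) x" for x
      by (simp add: orthogonal_transformation_norm[OF f] dist_norm)
    then have "indicator B (y - f x) = (indicator (ball (inv f y) 1) x :: ennreal)" for x
      by (simp add: B_def indicator_def)
    then show ?thesis
      by (simp add: B_def emeasure_ball)
  qed
  have "emeasure lborel B * (\<integral>\<^sup>+x. g (f x) \<partial>lborel)
      = (\<integral>\<^sup>+y. indicator B y * (\<integral>\<^sup>+x. g (f x) \<partial>lborel) \<partial>lborel)"
    by (simp add: nn_integral_multc)
  also have "\<dots> = (\<integral>\<^sup>+y. (\<integral>\<^sup>+x. indicator B y * g (y + f x) \<partial>lborel) \<partial>lborel)"
    by (subst nn_integral_cmult) (simp_all add: shift_f)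
  \<comment> \<open>With y as the inner variable, the shift by \<open>f x\<close> moves the
    dependence on x from \<open>g\<close> into the indicator.\<close>
  also have "\<dots> = (\<integral>\<^sup>+x. (\<integral>\<^sup>+y. indicator B y * g (y + f x) \<partial>lborel) \<partial>lborel)"
    by (rule lborel_pair.Fubini') measurable
  also have "\<dots> = (\<integral>\<^sup>+x. (\<integral>\<^sup>+y. indicator B (y - f x) * g y \<partial>lborel) \<partial>lborel)"
  proof (rule nn_integral_cong)
    fix x
    show "(\<integral>\<^sup>+y. indicator B y * g (y + f x) \<partial>lborel) = (\<integral>\<^sup>+y. indicator B (y - f x) * g y \<partial>lborel)"
      using nn_integral_lborel_add_left[of "\<lambda>y. indicator B (y - f x) * g y" "f x"]
      by (simp add: add.commute[of _ "f x"])
  qed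
  also have "\<dots> = (\<integral>\<^sup>+y. (\<integral>\<^sup>+x. indicator B (y - f x) * g y \<partial>lborel) \<partial>lborel)"
    by (rule lborel_pair.Fubini') measurable
  also have "\<dots> = emeasure lborel B * (\<integral>\<^sup>+y. g y \<partial>lborel)"
    by (subst nn_integral_multc) (simp_all add: ball_f nn_integral_cmult)
  finally have eq: "emeasure lborel B * (\<integral>\<^sup>+x. g (f x) \<partial>lborel) = emeasure lborel B * (\<integral>\<^sup>+y. g y \<partial>lborel)" .
  have "emeasure lborel B \<noteq> 0" "emeasure lborel B \<noteq> \<infinity>"
    using unit_ball_vol_pos[of "real DIM('a)"] by (simp_all add: B_def emeasure_ball less_imp_neq[symmetric])
  with eq show ?thesis
    by (simp add: ennreal_mult_cancel_left)
qed

text \<open>The radial form of the density; depending on \<open>norm z\<close> alone is what makes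
  the law rotation invariant.\<close>

lemma prod_std_normal_density:
  "(\<Prod>i\<in>UNIV. std_normal_density (z $ i)) =
     (1 / sqrt (2 * pi)) ^ CARD('n) * exp (- (norm z)\<^sup>2 / 2)" for z :: "real ^ 'n"
proof -
  have "(\<Sum>i\<in>UNIV. - (z $ i)\<^sup>2 / 2) = - (norm z)\<^sup>2 / 2"
    unfolding power2_norm_eq_inner inner_vec_def
    by (simp add: power2_eq_square sum_negf sum_divide_distrib[symmetric])
  then show ?thesis
    by (simp add: std_normal_density_def prod_dividef exp_sum[symmetric] power_one_over)
qed

lemma measurable_prod_std_normal_density [measurable]:
  "(\<lambda>z :: real ^ 'n. \<Prod>i\<in>UNIV. std_normal_density (z $ i)) \<in> borel_measurable borel"
  unfolding prod_std_normal_density by measurable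

lemma sets_std_gaussian [simp, measurable_cong]: "sets std_gaussian = sets borel"
  and space_std_gaussian [simp]: "space std_gaussian = UNIV"
  by (simp_all add: std_gaussian_def)

lemma distr_std_gaussian_orthogonal_transformation:
  fixes f :: "real ^ 'n \<Rightarrow> real ^ 'n"
  assumes f: "orthogonal_transformation f"
  shows "distr std_gaussian borel f = std_gaussian"
proof (rule measure_eqI)
  fix B :: "(real ^ 'n) set" assume "B \<in> sets (distr std_gaussian borel f)"
  then have [measurable]: "B \<in> sets borel" by simp
  have [measurable]: "f \<in> borel_measurable borel"
    using f by (simp add: borel_measurable_continuous_onI linear_continuous_on linear_linear
      orthogonal_transformation_linear)
  let ?p = "\<lambda>z :: real ^ 'n. ennreal (\<Prod>i\<in>UNIV. std_normal_density (z $ i))"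
  have p: "?p (f z) = ?p z" for z
    using f by (simp add: prod_std_normal_density orthogonal_transformation_norm)
  have "emeasure (distr std_gaussian borel f) B
      = (\<integral>\<^sup>+z. ?p (f z) * indicator B (f z) \<partial>lborel)"
    using measurable_sets_borel[of f borel B]
    by (simp add: emeasure_distr std_gaussian_def emeasure_density p indicator_vimage[symmetric])
  also have "\<dots> = (\<integral>\<^sup>+z. ?p z * indicator B z \<partial>lborel)"
    by (rule nn_integral_lborel_orthogonal_transformation[OF f]) measurable
  also have "\<dots> = emeasure std_gaussian B"
    by (simp add: std_gaussian_def emeasure_density)
  finally show "emeasure (distr std_gaussian borel f) B = emeasure std_gaussian B" .
qed simp

text \<open>The density is a product over coordinates. The indicator of \<open>B\<close> is absorbed
  into the factor of coordinate \<open>k\<close>, and every other factor integrates to 1.\<close>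

lemma distr_std_gaussian_component:
  "distr std_gaussian borel (\<lambda>z :: real ^ 'n. z $ k) = std_normal_distribution"
proof (rule measure_eqI)
  fix B :: "real set" assume "B \<in> sets (distr std_gaussian borel (\<lambda>z :: real ^ 'n. z $ k))"
  then have [measurable]: "B \<in> sets borel" by simp
  have one: "(\<integral>\<^sup>+x. ennreal (std_normal_density x) \<partial>lborel) = 1"
    using prob_space_normal_density[of 1 0]
    by (simp add: prob_space_def prob_space_axioms_def emeasure_density)
  let ?f = "\<lambda>b :: real ^ 'n. \<lambda>x. ennreal (std_normal_density x) * (if b = axis k 1 then indicator B x else 1)"
  have inj: "inj_on (\<lambda>i. axis i (1::real)) (UNIV :: 'n set)"
    by (simp add: inj_on_def axis_eq_axis)
  have Basis: "(Basis :: (real ^ 'n) set) = (\<lambda>i. axis i 1) ` UNIV"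
    by (auto simp: Basis_vec_def)
  have k: "(\<Prod>i\<in>UNIV. if i = k then c else (1::ennreal)) = c" for c
    by simp
  have "emeasure (distr std_gaussian borel (\<lambda>z :: real ^ 'n. z $ k)) B
     = (\<integral>\<^sup>+z. (\<Prod>b\<in>Basis. ?f b (z \<bullet> b)) \<partial>(lborel :: (real ^ 'n) measure))"
    using measurable_sets_borel[of "\<lambda>z :: real ^ 'n. z $ k" borel B]
    by (simp add: emeasure_distr std_gaussian_def emeasure_density Basis prod.reindex[OF inj]
        inner_axis axis_eq_axis prod.distrib k prod_ennreal indicator_def cong: if_cong)
  also have "\<dots> = (\<Prod>b\<in>(Basis :: (real ^ 'n) set). \<integral>\<^sup>+x. ?f b x \<partial>lborel)"
    by (rule nn_integral_lborel_prod) auto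
  also have "\<dots> = (\<Prod>i\<in>UNIV. if i = k then emeasure std_normal_distribution B else 1)"
    by (simp add: Basis prod.reindex[OF inj] axis_eq_axis del: prod.delta, rule prod.cong,
        auto simp: one emeasure_density)
  finally show "emeasure (distr std_gaussian borel (\<lambda>z :: real ^ 'n. z $ k)) B = emeasure std_normal_distribution B"
    by simp
qed simp

section \<open>Householder reflections, Gaussian projections, and dependence on the covariance
  alone\<close>

definition reflection :: "'a::real_inner \<Rightarrow> 'a \<Rightarrow> 'a" where
  "reflection u z = z - (2 * (u \<bullet> z) / (u \<bullet> u)) *\<^sub>R u"

lemma orthogonal_transformation_reflection: "orthogonal_transformation (reflection u)"
  for u :: "'a::euclidean_space"
\<comment> \<open>For \<open>u = 0\<close> the coefficient is a division by zero, hence 0, and the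
  map is the identity. No later use has to exclude this case.\<close>
proof (cases "u = 0")
  case True
  then have "reflection u = (\<lambda>z. z)"
    by (simp add: reflection_def fun_eq_iff)
  then show ?thesis by simp
next
  case False
  have "linear (reflection u)"
    by (rule linearI) (simp_all add: reflection_def inner_right_distrib algebra_simps add_divide_distrib)
  moreover have "reflection u v \<bullet> reflection u w = v \<bullet> w" for v w
    using False by (simp add: reflection_def inner_diff_left inner_diff_right inner_commute field_simps)
  ultimately show ?thesis
    by (simp add: orthogonal_transformation_def)
qed

text \<open>For vectors of equal length, \<bar>s - t\<bar>^2 is twice the inner product of
  \<open>s - t\<close> with \<open>s\<close>, so the coefficient of \<open>s - t\<close> is exactly
  1.\<close>

lemma reflection_swap:
  assumes "norm s = norm t"
  shows "reflection (s - t) s = t"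
proof (cases "s = t")
  case False
  have "s \<bullet> s = t \<bullet> t"
    using assms by (simp add: norm_eq)
  then have "(s - t) \<bullet> (s - t) = 2 * ((s - t) \<bullet> s)"
    by (simp add: inner_diff_left inner_diff_right inner_commute)
  moreover have "(s - t) \<bullet> (s - t) \<noteq> 0"
    using False by simp
  ultimately show ?thesis
    by (simp add: reflection_def)
qed (simp add: reflection_def)

lemma reflection_orthogonal: "u \<bullet> z = 0 \<Longrightarrow> reflection u z = z"
  by (simp add: reflection_def)

lemma distr_std_gaussian_inner:
  fixes a :: "real ^ 'n"
  shows "distr std_gaussian borel (\<lambda>z. a \<bullet> z) = distr std_normal_distribution borel (\<lambda>x. norm a * x)"
proof -
  \<comment> \<open>Index types are nonempty, so some coordinate exists. Reflecting \<open>a\<close>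
    onto that axis reduces the claim to the law of one coordinate.\<close>
  fix k :: 'n
  define f where "f = reflection (a - norm a *\<^sub>R axis k 1)"
  have f: "orthogonal_transformation f"
    by (simp add: f_def orthogonal_transformation_reflection)
  have [measurable]: "f \<in> borel_measurable borel"
    using f by (simp add: borel_measurable_continuous_onI linear_continuous_on linear_linear
      orthogonal_transformation_linear)
  have "f a = norm a *\<^sub>R axis k 1"
    unfolding f_def by (rule reflection_swap) simp
  moreover have "a \<bullet> z = f a \<bullet> f z" for z
    using f by (simp add: orthogonal_transformation_def)
  ultimately have "(\<lambda>z. a \<bullet> z) = (\<lambda>z. norm a * (f z $ k))"
    by (simp add: fun_eq_iff inner_axis')
  then have "distr std_gaussian borel (\<lambda>z. a \<bullet> z)
      = distr (distr std_gaussian borel f) borel (\<lambda>z. norm a * (z $ k))"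
    by (simp add: distr_distr comp_def)
  also have "\<dots> = distr (distr std_gaussian borel (\<lambda>z. z $ k)) borel (\<lambda>x. norm a * x)"
    by (simp add: distr_std_gaussian_orthogonal_transformation[OF f] distr_distr comp_def)
  finally show ?thesis
    by (simp add: distr_std_gaussian_component)
qed

text \<open>Householder reflections, chosen one vector at a time, each fixing the vectors already placed.\<close>
lemma gram_eq_imp_orthogonal_transformation:
  fixes s t :: "'i \<Rightarrow> 'a::euclidean_space"
  assumes "finite I" and "\<And>i j. i \<in> I \<Longrightarrow> j \<in> I \<Longrightarrow> s i \<bullet> s j = t i \<bullet> t j"
  obtains R where "orthogonal_transformation R" and "\<And>i. i \<in> I \<Longrightarrow> R (s i) = t i"
  using assms
proof (induction I arbitrary: thesis rule: finite_induct)
  case empty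
  show ?case
    by (rule empty.prems(1)[of "\<lambda>x. x"]) simp_all
next
  case (insert k I)
  obtain R where R: "orthogonal_transformation R" and Rs: "\<And>i. i \<in> I \<Longrightarrow> R (s i) = t i"
    using insert.IH insert.prems(2) by (metis insertCI)
  have inner_R: "R v \<bullet> R w = v \<bullet> w" for v w
    using R by (simp add: orthogonal_transformation_def)
  define F where "F = reflection (R (s k) - t k)"
  have F: "orthogonal_transformation F"
    by (simp add: F_def orthogonal_transformation_reflection)
  have "norm (R (s k)) = norm (t k)"
    using insert.prems(2)[of k k] by (simp add: norm_eq inner_R)
  then have Fk: "F (R (s k)) = t k"
    by (simp add: F_def reflection_swap)
  have "F (R (s i)) = t i" if "i \<in> I" for i
  proof -
    have "R (s k) \<bullet> R (s i) = t k \<bullet> t i"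
      using insert.prems(2)[of k i] that by (simp add: inner_R)
    then have "(R (s k) - t k) \<bullet> t i = 0"
      using Rs[OF that] by (simp add: inner_diff_left)
    then show ?thesis
      using Rs[OF that] by (simp add: F_def reflection_orthogonal)
  qed
  with Fk F R show ?case
    by (intro insert.prems(1)[of "F \<circ> R"])
       (auto intro: orthogonal_transformation_compose[unfolded comp_def])
qed

lemma measurable_matrix_vector_mult [measurable (raw)]:
  "f \<in> borel_measurable M \<Longrightarrow> (\<lambda>x. A *v f x) \<in> borel_measurable M" for A :: "real ^ 'n ^ 'm"
  by (rule measurable_compose[OF _ borel_measurable_continuous_onI[OF matrix_vector_mult_linear_continuous_on]])

text \<open>The hypothesis says that the rows of \<open>S\<close> and \<open>T\<close> have the same
  Gram matrix. Hence an orthogonal \<open>R\<close> carries the rows of \<open>S\<close> to those of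
  \<open>T\<close>, so \<open>T *v R z = S *v z\<close>, and rotation invariance absorbs
  \<open>R\<close>.\<close>

lemma distr_std_gaussian_cov_unique:
  fixes S T :: "real ^ 'n ^ 'n"
  assumes "S ** transpose S = T ** transpose T"
  shows "distr std_gaussian borel (\<lambda>z. S *v z + \<mu>) = distr std_gaussian borel (\<lambda>z. T *v z + \<mu>)"
proof -
  have "S $ i \<bullet> S $ j = T $ i \<bullet> T $ j" for i j
  proof -
    have "(S ** transpose S) $ i $ j = (T ** transpose T) $ i $ j"
      using assms by simp
    then show ?thesis
      by (simp add: matrix_matrix_mult_def transpose_def inner_vec_def)
  qed
  then obtain R where R: "orthogonal_transformation R" and RS: "\<And>i. R (S $ i) = T $ i"
    using gram_eq_imp_orthogonal_transformation[of UNIV "($) S" "($) T"] by (metis UNIV_I finite)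
  have [measurable]: "R \<in> borel_measurable borel"
    using R by (simp add: borel_measurable_continuous_onI linear_continuous_on linear_linear
      orthogonal_transformation_linear)
  have "T *v R z = S *v z" for z
  proof -
    have "T $ i \<bullet> R z = S $ i \<bullet> z" for i
      using R by (simp add: RS[symmetric] orthogonal_transformation_def)
    then show ?thesis
      by (simp add: vec_eq_iff matrix_vector_mult_def inner_vec_def)
  qed
  then have "distr std_gaussian borel (\<lambda>z. S *v z + \<mu>)
      = distr (distr std_gaussian borel R) borel (\<lambda>z. T *v z + \<mu>)"
    by (subst distr_distr) (simp_all add: comp_def)
  then show ?thesis
    by (simp add: distr_std_gaussian_orthogonal_transformation[OF R])
qed

subsection \<open>One-dimensional Gaussian integrals of tanh\<close>

text \<open>The mean value inequality bounds every difference quotient by \<open>B\<close>, so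
  dominated convergence applies along each sequence tending to \<open>u\<close>.\<close>

lemma has_real_derivative_lebesgue_integral:
  fixes f f' :: "real \<Rightarrow> 'a \<Rightarrow> real"
  assumes deriv: "\<And>t x. x \<in> space M \<Longrightarrow> ((\<lambda>t. f t x) has_real_derivative f' t x) (at t)"
    and int: "\<And>t. integrable M (f t)"
    and meas: "f' u \<in> borel_measurable M"
    and bound: "\<And>t x. x \<in> space M \<Longrightarrow> \<bar>f' t x\<bar> \<le> B x"
    and B: "integrable M B"
  shows "((\<lambda>t. \<integral>x. f t x \<partial>M) has_real_derivative (\<integral>x. f' u x \<partial>M)) (at u)"
  unfolding has_field_derivative_iff tendsto_at_iff_sequentially comp_def
proof safe
  fix X :: "nat \<Rightarrow> real"
  assume X: "\<forall>i. X i \<in> UNIV - {u}" and lim: "X \<longlonglongrightarrow> u"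
  have "(\<lambda>i. \<integral>x. (f (X i) x - f u x) / (X i - u) \<partial>M) \<longlonglongrightarrow> (\<integral>x. f' u x \<partial>M)"
  proof (rule integral_dominated_convergence[where w = B])
    show "AE x in M. (\<lambda>i. (f (X i) x - f u x) / (X i - u)) \<longlonglongrightarrow> f' u x"
    proof (rule AE_I2)
      fix x assume "x \<in> space M"
      from deriv[OF this, of u] show "(\<lambda>i. (f (X i) x - f u x) / (X i - u)) \<longlonglongrightarrow> f' u x"
        using X lim unfolding has_field_derivative_iff tendsto_at_iff_sequentially comp_def by blast
    qed
    show "AE x in M. norm ((f (X i) x - f u x) / (X i - u)) \<le> B x" for i
    proof (rule AE_I2)
      fix x assume x: "x \<in> space M"
      have "norm (f (X i) x - f u x) \<le> B x * norm (X i - u)"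
        using deriv[OF x] bound[OF x]
        by (intro field_differentiable_bound[of UNIV "\<lambda>t. f t x" "\<lambda>t. f' t x"]) auto
      then show "norm ((f (X i) x - f u x) / (X i - u)) \<le> B x"
        using X by (simp add: field_simps)
    qed
    show "(\<lambda>x. (f (X i) x - f u x) / (X i - u)) \<in> borel_measurable M" for i
      using int by measurable
  qed (use B meas in auto)
  then show "(\<lambda>i. ((\<integral>x. f (X i) x \<partial>M) - (\<integral>x. f u x \<partial>M)) / (X i - u)) \<longlonglongrightarrow> (\<integral>x. f' u x \<partial>M)"
    using int by simp
qed

section \<open>Elementary inequalities for tanh\<close>

lemma measurable_tanh [measurable]: "(tanh :: real \<Rightarrow> real) \<in> borel_measurable borel"
  by (intro borel_measurable_continuous_onI continuous_intros) (simp add: cosh_real_nonzero)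

lemma abs_tanh_le_1: "\<bar>tanh x\<bar> \<le> 1" for x :: real
  using tanh_real_bounds[of x] by (simp add: abs_le_iff)

text \<open>The difference of the two sides vanishes at 0 and has derivative
  \<open>2 * y * tanh y * (1 - (tanh y)^2)\<close>, positive for y > 0. It fixes the sign of the
  derivative of \<open>tanh y / y\<close>.\<close>

lemma mult_sech_squared_less_tanh:
  fixes x :: real
  assumes "0 < x"
  shows "x * (1 - (tanh x)\<^sup>2) < tanh x"
proof -
  define f where "f y = tanh y - y * (1 - (tanh y)\<^sup>2)" for y :: real
  have "(f has_real_derivative 2 * y * tanh y * (1 - (tanh y)\<^sup>2)) (at y)" for y
    unfolding f_def by (auto intro!: derivative_eq_intros simp: cosh_real_nonzero algebra_simps power2_eq_square)
  moreover have "0 < 2 * y * tanh y * (1 - (tanh y)\<^sup>2)" if "0 < y" for y :: real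
    using that tanh_real_bounds[of y] by (simp add: abs_square_less_1 abs_less_iff)
  moreover have "continuous_on {0..x} f"
    unfolding f_def by (intro continuous_intros) (auto simp: cosh_real_nonzero)
  ultimately have "f 0 < f x"
    using assms by (intro DERIV_pos_imp_increasing_open[of 0 x f]) blast+
  then show ?thesis by (simp add: f_def)
qed

lemma tanh_over_self_strict_decreasing:
  fixes x y :: real
  assumes "0 < x" "x < y"
  shows "tanh y / y < tanh x / x"
proof (rule DERIV_neg_imp_decreasing_open[OF assms(2)])
  fix z assume "x < z" "z < y"
  then have "0 < z" using assms by simp
  then have "((\<lambda>z. tanh z / z) has_real_derivative (z * (1 - (tanh z)\<^sup>2) - tanh z) / z\<^sup>2) (at z)"
    by (auto intro!: derivative_eq_intros simp: cosh_real_nonzero algebra_simps power2_eq_square)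
  moreover have "(z * (1 - (tanh z)\<^sup>2) - tanh z) / z\<^sup>2 < 0"
    using mult_sech_squared_less_tanh[OF \<open>0 < z\<close>] \<open>0 < z\<close> by (simp add: divide_neg_pos)
  ultimately show "\<exists>D. ((\<lambda>z. tanh z / z) has_real_derivative D) (at z) \<and> D < 0"
    by blast
next
  show "continuous_on {x..y} (\<lambda>z. tanh z / z)"
    using assms by (intro continuous_intros) (auto simp: cosh_real_nonzero)
qed

lemma abs_tanh_le: "\<bar>tanh x\<bar> \<le> \<bar>x\<bar>" for x :: real
proof -
  have le: "tanh y \<le> y" if "0 \<le> y" for y :: real
  proof -
    have "0 - tanh 0 \<le> y - tanh y"
    proof (rule DERIV_nonneg_imp_nondecreasing[OF that])
      fix z :: real
      have "((\<lambda>z. z - tanh z) has_real_derivative (tanh z)\<^sup>2) (at z)"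
        by (auto intro!: derivative_eq_intros simp: cosh_real_nonzero)
      then show "\<exists>D. ((\<lambda>z. z - tanh z) has_real_derivative D) (at z) \<and> 0 \<le> D"
        by auto
    qed
    then show ?thesis by simp
  qed
  show ?thesis
    using le[of x] le[of "- x"] by (cases "0 \<le> x") auto
qed

text \<open>Intermediate values of \<open>tanh y - a * y\<close>: its slope at 0 is
  \<open>1 - a > 0\<close>, so it is positive just after 0, while tanh < 1 makes it nonpositive at
  \<open>1 / a\<close>.\<close>

lemma ex_tanh_over_self_eq:
  fixes a :: real
  assumes "0 < a" "a < 1"
  obtains y where "0 < y" "tanh y / y = a"
proof -
  define f where "f y = tanh y - a * y" for y :: real
  have "(f has_real_derivative 1 - a) (at 0)"
    unfolding f_def by (auto intro!: derivative_eq_intros simp: cosh_real_nonzero)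
  then obtain e where e: "0 < e" "\<And>h. 0 < h \<Longrightarrow> h < e \<Longrightarrow> f 0 < f (0 + h)"
    using DERIV_pos_inc_right[of f "1 - a" 0] assms by auto
  \<comment> \<open>Half of \<open>e\<close> stays where the function is positive; the cap at 1
    keeps \<open>y0\<close> below \<open>1 / a\<close>, since a < 1.\<close>
  define y0 where "y0 = min (e / 2) 1"
  have "1 \<le> 1 / a"
    using assms by simp
  then have y0: "0 < y0" "0 \<le> f y0" "y0 \<le> 1 / a"
    using e(1) e(2)[of y0] by (auto simp: y0_def f_def min_def)
  have "f (1 / a) \<le> 0"
    using assms tanh_real_lt_1[of "1 / a"] by (simp add: f_def)
  moreover have "\<forall>x. y0 \<le> x \<and> x \<le> 1 / a \<longrightarrow> isCont f x"
    unfolding f_def by (auto intro!: continuous_intros simp: cosh_real_nonzero)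
  ultimately obtain y where "y0 \<le> y" "f y = 0"
    using IVT2[of f "1 / a" 0 y0] y0 by auto
  then show thesis
    using y0 that[of y] by (simp add: f_def field_simps)
qed

section \<open>Single-crossing inequalities for one-dimensional Gaussian integrals\<close>

lemma integral_std_normal_distribution_affine:
  fixes f :: "real \<Rightarrow> real"
  assumes [measurable]: "f \<in> borel_measurable borel" and "0 < s"
  shows "(\<integral>x. f (m + s * x) \<partial>std_normal_distribution) = (\<integral>w. normal_density m s w * f w \<partial>lborel)"
    and "integrable std_normal_distribution (\<lambda>x. f (m + s * x)) \<longleftrightarrow>
         integrable lborel (\<lambda>w. normal_density m s w * f w)"
proof -
  have d: "std_normal_density x = s * normal_density m s (m + s * x)" for x
    using \<open>0 < s\<close> by (simp add: normal_density_def real_sqrt_mult power_mult_distrib)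
  have "(\<integral>x. f (m + s * x) \<partial>std_normal_distribution)
      = (\<integral>x. s * (normal_density m s (m + s * x) * f (m + s * x)) \<partial>lborel)"
    by (subst integral_density) (simp_all add: d[symmetric] mult.assoc[symmetric])
  also have "\<dots> = (\<integral>w. normal_density m s w * f w \<partial>lborel)"
    using \<open>0 < s\<close>
    by (subst (2) lborel_integral_real_affine[where c = s and t = m]) simp_all
  finally show "(\<integral>x. f (m + s * x) \<partial>std_normal_distribution) = (\<integral>w. normal_density m s w * f w \<partial>lborel)" .
  have "integrable std_normal_distribution (\<lambda>x. f (m + s * x)) \<longleftrightarrow>
      integrable lborel (\<lambda>x. s * (normal_density m s (m + s * x) * f (m + s * x)))"
    by (subst integrable_density) (simp_all add: d[symmetric] mult.assoc[symmetric])
  also have "\<dots> \<longleftrightarrow> integrable lborel (\<lambda>w. normal_density m s w * f w)"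
    using \<open>0 < s\<close>
      lborel_integrable_real_affine_iff[of s "\<lambda>w. normal_density m s w * f w" m] by simp
  finally show "integrable std_normal_distribution (\<lambda>x. f (m + s * x)) \<longleftrightarrow>
         integrable lborel (\<lambda>w. normal_density m s w * f w)" .
qed

lemma integrable_std_normal_distribution_bounded_mult_power:
  fixes k :: "real \<Rightarrow> real"
  assumes [measurable]: "k \<in> borel_measurable borel" and "\<And>x. \<bar>k x\<bar> \<le> K"
  shows "integrable std_normal_distribution (\<lambda>x. k x * x ^ n)"
proof (rule Bochner_Integration.integrable_bound)
  show "integrable std_normal_distribution (\<lambda>x. K * x ^ n)"
    using integrable_std_normal_distribution_moment[of n] by simp
  have "\<bar>k x\<bar> \<le> \<bar>K\<bar>" for x
    using assms(2)[of x] by simp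
  then show "AE x in std_normal_distribution. norm (k x * x ^ n) \<le> norm (K * x ^ n)"
    by (auto simp: abs_mult intro!: mult_right_mono)
qed simp

lemma integral_std_normal_distribution_id: "(\<integral>x. x \<partial>std_normal_distribution) = 0"
  using integral_std_normal_distribution_moment_odd[of 1] by simp

lemma integral_std_normal_distribution_square: "(\<integral>x. x\<^sup>2 \<partial>std_normal_distribution) = 1"
  using std_normal_distribution_even_moments(1)[of 1] by simp

text \<open>
  Folding the density at \<open>0\<close> multiplies the quadratic by \<open>1 - (r\<^sup>2 / s\<^sup>2) * tanh y / y\<close>, where \<open>y = m * w / s\<^sup>2\<close>
  and \<open>r\<^sup>2 = m\<^sup>2 + s\<^sup>2\<close>; this changes sign once, at \<open>y0\<close>, from negative to positive.
  As the quadratic has mean zero, the value of \<open>k\<close> at the crossing may be subtracted from \<open>k\<close>.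
\<close>
lemma integral_decreasing_mult_quadratic_neg:
  fixes k :: "real \<Rightarrow> real"
  assumes "0 < m" "0 < s"
    and [measurable]: "k \<in> borel_measurable borel"
    and bound: "\<And>x. \<bar>k x\<bar> \<le> K"
    and even: "\<And>x. k (- x) = k x"
    and decr: "\<And>x y. 0 < x \<Longrightarrow> x < y \<Longrightarrow> k y < k x"
  shows "(\<integral>x. k (m + s * x) * (m * (m + s * x)\<^sup>2 - (m\<^sup>2 + s\<^sup>2) * (m + s * x)) \<partial>std_normal_distribution) < 0"
proof -
  define q where "q w = m * w\<^sup>2 - (m\<^sup>2 + s\<^sup>2) * w" for w
  have [measurable]: "q \<in> borel_measurable borel"
    unfolding q_def by measurable
  have "s\<^sup>2 / (m\<^sup>2 + s\<^sup>2) < 1" "0 < s\<^sup>2 / (m\<^sup>2 + s\<^sup>2)"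
    using \<open>0 < m\<close> \<open>0 < s\<close> by (simp_all add: divide_less_eq add_pos_pos)
  then obtain y0 where y0: "0 < y0" "tanh y0 / y0 = s\<^sup>2 / (m\<^sup>2 + s\<^sup>2)"
    using ex_tanh_over_self_eq by blast
  \<comment> \<open>The point where \<open>m * w / s^2\<close> reaches \<open>y0\<close>.\<close>
  define w0 where "w0 = y0 * s\<^sup>2 / m"
  have "0 < w0"
    using y0 \<open>0 < m\<close> \<open>0 < s\<close> by (simp add: w0_def)
  define F where "F w = (k w - k w0) * q w" for w
  have [measurable]: "F \<in> borel_measurable borel"
    unfolding F_def by measurable
  have int: "integrable std_normal_distribution (\<lambda>x. h (m + s * x) * q (m + s * x))"
    if [measurable]: "h \<in> borel_measurable borel" and "\<And>x. \<bar>h x\<bar> \<le> C" for h C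
  proof -
    have "integrable std_normal_distribution (\<lambda>x. h (m + s * x) * x ^ n)" for n
      using that by (intro integrable_std_normal_distribution_bounded_mult_power) auto
    from this[of 0] this[of 1] this[of 2]
    have "integrable std_normal_distribution (\<lambda>x. (m * m\<^sup>2 - (m\<^sup>2 + s\<^sup>2) * m) * h (m + s * x)
        + (2 * m * m * s - (m\<^sup>2 + s\<^sup>2) * s) * (h (m + s * x) * x) + m * s\<^sup>2 * (h (m + s * x) * x\<^sup>2))"
      by (intro Bochner_Integration.integrable_add integrable_mult_right) simp_all
    then show ?thesis
      by (rule Bochner_Integration.integrable_cong[THEN iffD1, OF refl, rotated])
        (simp add: q_def power2_eq_square algebra_simps)
  qed
  have q_int: "integrable std_normal_distribution (\<lambda>x. q (m + s * x))"
    using int[of "\<lambda>_. 1" 1] by simp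
  have kq_int: "integrable std_normal_distribution (\<lambda>x. k (m + s * x) * q (m + s * x))"
    using bound by (intro int) auto
  have mom: "integrable std_normal_distribution (\<lambda>x. x)" "integrable std_normal_distribution (\<lambda>x. x\<^sup>2)"
    using integrable_std_normal_distribution_moment[of 1] integrable_std_normal_distribution_moment[of 2] by simp_all
  interpret std_normal: prob_space std_normal_distribution
    by (rule prob_space_normal_density) simp
  \<comment> \<open>With w = m + s x the first two moments are m and m^2 + s^2, so the two terms of
    \<open>q\<close> have equal means.\<close>
  have "(\<integral>x. q (m + s * x) \<partial>std_normal_distribution)
      = (\<integral>x. (m * m\<^sup>2 - (m\<^sup>2 + s\<^sup>2) * m)
          + (2 * m * m * s - (m\<^sup>2 + s\<^sup>2) * s) * x + m * s\<^sup>2 * x\<^sup>2 \<partial>std_normal_distribution)"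
    by (rule Bochner_Integration.integral_cong) (simp_all add: q_def power2_eq_square algebra_simps)
  also have "\<dots> = (m * m\<^sup>2 - (m\<^sup>2 + s\<^sup>2) * m) + m * s\<^sup>2"
    using mom std_normal.prob_space
    by (simp add: integral_std_normal_distribution_id integral_std_normal_distribution_square
      del: right_diff_distrib left_diff_distrib)
  also have "\<dots> = 0"
    by (simp add: algebra_simps)
  finally have q_zero: "(\<integral>x. q (m + s * x) \<partial>std_normal_distribution) = 0" .
  \<comment> \<open>The density form over Lebesgue measure allows w to be paired with -w.\<close>
  define G where "G w = normal_density m s w * F w" for w
  have F_int: "integrable std_normal_distribution (\<lambda>x. F (m + s * x))"
    unfolding F_def left_diff_distrib using q_int kq_int by simp
  then have G_int: "integrable lborel G"
    unfolding G_def using \<open>0 < s\<close> by (simp add: integral_std_normal_distribution_affine)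
  then have G_int': "integrable lborel (\<lambda>w. G (- w))"
    using lborel_integrable_real_affine[of G "-1" 0] by simp
  have G_refl: "(\<integral>w. G (- w) \<partial>lborel) = (\<integral>w. G w \<partial>lborel)"
    using lborel_integral_real_affine[of "-1" G 0] by simp
  have fold: "G w + G (- w) < 0" if w: "0 < w" "w \<noteq> w0" for w
  proof -
    define y where "y = m * w / s\<^sup>2"
    \<comment> \<open>\<open>D\<close> is the part of the density that is even in w; what remains at
      w and -w is \<open>exp y\<close> and \<open>exp (- y)\<close>.\<close>
    define D where "D = exp (- (w\<^sup>2 + m\<^sup>2) / (2 * s\<^sup>2)) / sqrt (2 * pi * s\<^sup>2)"
    have "0 < y" "0 < D"
      using w \<open>0 < m\<close> \<open>0 < s\<close> by (simp_all add: y_def D_def)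
    have d1: "normal_density m s w = D * exp y"
      using \<open>0 < s\<close> by (simp add: normal_density_def D_def y_def exp_add[symmetric] field_simps power2_eq_square)
    have d2: "normal_density m s (- w) = D * exp (- y)"
      using \<open>0 < s\<close> by (simp add: normal_density_def D_def y_def exp_add[symmetric] field_simps power2_eq_square)
    have "G w + G (- w) = (k w - k w0) * (m * w\<^sup>2 * D * (exp y + exp (- y))
        - (m\<^sup>2 + s\<^sup>2) * w * D * (exp y - exp (- y)))"
      by (simp add: G_def F_def q_def d1 d2 even algebra_simps)
    also have "exp y + exp (- y) = 2 * cosh y"
      by (simp add: cosh_field_def)
    also have "exp y - exp (- y) = 2 * cosh y * tanh y"
      by (simp add: tanh_def sinh_field_def cosh_real_nonzero)
    \<comment> \<open>The threshold s^2 / (m^2 + s^2) is replaced by \<open>tanh y0 / y0\<close>.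
      Both differences in the last product then change sign at \<open>w0\<close>, in opposite
      directions.\<close>
    also have "(k w - k w0) * (m * w\<^sup>2 * D * (2 * cosh y) - (m\<^sup>2 + s\<^sup>2) * w * D * (2 * cosh y * tanh y))
        = 2 * D * cosh y * m * w\<^sup>2 * (m\<^sup>2 + s\<^sup>2) / s\<^sup>2 * ((k w - k w0) * (tanh y0 / y0 - tanh y / y))"
      using w \<open>0 < m\<close> \<open>0 < s\<close> unfolding y0 y_def
      by (simp add: field_simps power2_eq_square add_pos_pos less_imp_neq[symmetric])
    also have "\<dots> < 0"
    proof (rule mult_pos_neg)
      show "0 < 2 * D * cosh y * m * w\<^sup>2 * (m\<^sup>2 + s\<^sup>2) / s\<^sup>2"
        using w \<open>0 < m\<close> \<open>0 < s\<close> \<open>0 < D\<close> by (simp add: cosh_real_pos add_pos_pos)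
      consider "w < w0" | "w0 < w"
        using w by linarith
      then show "(k w - k w0) * (tanh y0 / y0 - tanh y / y) < 0"
      proof cases
        case 1
        then have "y < y0"
          using \<open>0 < m\<close> \<open>0 < s\<close> by (simp add: y_def w0_def field_simps)
        with 1 w \<open>0 < y\<close> show ?thesis
          using decr[of w w0] tanh_over_self_strict_decreasing[of y y0] by (simp add: mult_pos_neg)
      next
        case 2
        then have "y0 < y"
          using \<open>0 < m\<close> \<open>0 < s\<close> by (simp add: y_def w0_def field_simps)
        with 2 \<open>0 < w0\<close> y0(1) show ?thesis
          using decr[of w0 w] tanh_over_self_strict_decreasing[of y0 y] by (simp add: mult_neg_pos)
      qed
    qed
    finally show ?thesis .
  qed
  \<comment> \<open>The folded integrand is even, so negative w reduce to positive ones; the three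
    exceptional points form a null set.\<close>
  have fold_AE: "AE w in lborel. G w + G (- w) < 0"
  proof -
    have "AE w in lborel. w \<noteq> 0 \<and> w \<noteq> w0 \<and> w \<noteq> - w0"
      using AE_lborel_singleton[of 0] AE_lborel_singleton[of w0] AE_lborel_singleton[of "- w0"] by auto
    then show ?thesis
    proof (rule AE_mp, intro AE_I2 impI)
      fix w assume "w \<noteq> 0 \<and> w \<noteq> w0 \<and> w \<noteq> - w0"
      then show "G w + G (- w) < 0"
        using fold[of w] fold[of "- w"] by (cases "0 < w") (auto simp: add.commute)
    qed
  qed
  have "0 \<le> (\<integral>w. - (G w + G (- w)) \<partial>lborel)"
    using fold_AE by (intro integral_nonneg_AE) auto
  \<comment> \<open>Strictness: a nonnegative function with zero integral vanishes almost
    everywhere, against the strict sign just obtained. The folded integral is twice that of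
    \<open>G\<close>.\<close>
  moreover have "(\<integral>w. - (G w + G (- w)) \<partial>lborel) \<noteq> 0"
  proof
    assume "(\<integral>w. - (G w + G (- w)) \<partial>lborel) = 0"
    then have "AE w in lborel. - (G w + G (- w)) = 0"
      using fold_AE G_int G_int'
      by (subst (asm) integral_nonneg_eq_0_iff_AE) auto
    with fold_AE have "AE w in (lborel :: real measure). False"
      by eventually_elim simp
    then show False
      by (simp add: trivial_limit_def[symmetric] ae_filter_eq_bot_iff)
  qed
  ultimately have "(\<integral>w. G w \<partial>lborel) < 0"
    using G_int G_int' by (simp add: G_refl)
  also have "(\<integral>w. G w \<partial>lborel) = (\<integral>x. F (m + s * x) \<partial>std_normal_distribution)"
    unfolding G_def using \<open>0 < s\<close> by (simp add: integral_std_normal_distribution_affine)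
  also have "\<dots> = (\<integral>x. k (m + s * x) * q (m + s * x) \<partial>std_normal_distribution)"
    unfolding F_def left_diff_distrib using q_int kq_int by (simp add: q_zero)
  finally show ?thesis
    by (simp add: q_def)
qed

text \<open>The crossing inequality for \<open>tanh w / w\<close>: at w = m + s x,
  \<open>m * w - (m^2 + s^2)\<close> equals \<open>- s * (s - m * x)\<close>. This positivity later
  gives the nonzero slope that identifies the mean.\<close>

lemma integral_tanh_normal_pos:
  fixes m s :: real
  assumes "0 < m" "0 < s"
  shows "0 < (\<integral>x. (s - m * x) * tanh (m + s * x) \<partial>std_normal_distribution)"
proof -
  let ?k = "\<lambda>w :: real. tanh w / w"
  have "(\<integral>x. ?k (m + s * x) * (m * (m + s * x)\<^sup>2 - (m\<^sup>2 + s\<^sup>2) * (m + s * x)) \<partial>std_normal_distribution) < 0"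
    using abs_tanh_le assms
    by (intro integral_decreasing_mult_quadratic_neg[where K = 1] tanh_over_self_strict_decreasing)
      (auto simp: divide_le_eq)
  also have "(\<integral>x. ?k (m + s * x) * (m * (m + s * x)\<^sup>2 - (m\<^sup>2 + s\<^sup>2) * (m + s * x)) \<partial>std_normal_distribution)
      = (\<integral>x. - s * ((s - m * x) * tanh (m + s * x)) \<partial>std_normal_distribution)"
  proof (rule Bochner_Integration.integral_cong[OF refl])
    fix x
    have "?k w * (m * w\<^sup>2 - (m\<^sup>2 + s\<^sup>2) * w) = tanh w * (m * w - (m\<^sup>2 + s\<^sup>2))" for w :: real
      by (cases "w = 0") (simp_all add: field_simps power2_eq_square)
    then show "?k (m + s * x) * (m * (m + s * x)\<^sup>2 - (m\<^sup>2 + s\<^sup>2) * (m + s * x))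
        = - s * ((s - m * x) * tanh (m + s * x))"
      by (simp only:) (simp add: algebra_simps power2_eq_square)
  qed
  finally show ?thesis
    using \<open>0 < s\<close> by (simp add: zero_less_mult_iff mult_less_0_iff)
qed

text \<open>Moving along a circle keeps m^2 + s^2 fixed. With m = r cos \<theta>, s = r sin
  \<theta>, the derivative in \<theta> is the mean of g'(w) (m x - s), and s times it is the
  crossing integral for g'(w) / w, which is negative.\<close>

lemma integral_mult_tanh_normal_strict_decreasing:
  fixes r :: real
  assumes "0 < r" "0 \<le> \<alpha>" "\<alpha> < \<beta>" "\<beta> \<le> pi / 2"
  defines "g \<equiv> \<lambda>w :: real. w * tanh w"
  shows "(\<integral>x. g (r * cos \<beta> + r * sin \<beta> * x) \<partial>std_normal_distribution)
       < (\<integral>x. g (r * cos \<alpha> + r * sin \<alpha> * x) \<partial>std_normal_distribution)"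
proof -
  interpret std_normal: prob_space std_normal_distribution
    by (rule prob_space_normal_density) simp
  define g' where "g' w = tanh w + w * (1 - (tanh w)\<^sup>2)" for w :: real
  have [measurable]: "g \<in> borel_measurable borel" "g' \<in> borel_measurable borel"
    unfolding g_def g'_def by measurable
  have g_deriv: "(g has_real_derivative g' w) (at w)" for w
    unfolding g_def g'_def
    by (auto intro!: derivative_eq_intros simp: cosh_real_nonzero algebra_simps)
  have tanh_sq: "(tanh w)\<^sup>2 \<le> 1" for w :: real
    by (simp add: abs_square_le_1 abs_tanh_le_1)
  have g'_bound: "\<bar>g' w\<bar> \<le> 2" for w
  proof -
    have *: "\<bar>w * (1 - (tanh w)\<^sup>2)\<bar> \<le> 1" if "0 < w" for w :: real
      using mult_sech_squared_less_tanh[OF that] tanh_real_lt_1[of w] tanh_sq[of w] that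
      by (simp add: abs_mult)
    have "\<bar>w * (1 - (tanh w)\<^sup>2)\<bar> \<le> 1"
      using *[of w] *[of "- w"] by (cases w "0 :: real" rule: linorder_cases) simp_all
    then show ?thesis
      using abs_tanh_le_1[of w] unfolding g'_def by linarith
  qed
  have mom: "integrable std_normal_distribution (\<lambda>x. x)" "integrable std_normal_distribution (\<lambda>x. \<bar>x\<bar>)"
    using integrable_std_normal_distribution_moment[of 1] integrable_abs[of _ "\<lambda>x. x"] by simp_all
  have g_int: "integrable std_normal_distribution (\<lambda>x. g (a + b * x))" for a b
  proof (rule Bochner_Integration.integrable_bound)
    show "integrable std_normal_distribution (\<lambda>x. a + b * x)"
      using mom by simp
    show "AE x in std_normal_distribution. norm (g (a + b * x)) \<le> norm (a + b * x)"
      by (auto simp: g_def abs_mult abs_tanh_le_1 intro!: mult_left_le)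
  qed simp
  define h where "h \<theta> = (\<integral>x. g (r * cos \<theta> + r * sin \<theta> * x) \<partial>std_normal_distribution)" for \<theta>
  define h' where "h' \<theta> = (\<integral>x. g' (r * cos \<theta> + r * sin \<theta> * x) * (- r * sin \<theta> + r * cos \<theta> * x)
      \<partial>std_normal_distribution)" for \<theta>
  have h_deriv: "(h has_real_derivative h' \<theta>) (at \<theta>)" for \<theta>
    unfolding h_def h'_def
  proof (rule has_real_derivative_lebesgue_integral[where B = "\<lambda>x. 2 * (r + r * \<bar>x\<bar>)"])
    show "((\<lambda>t. g (r * cos t + r * sin t * x)) has_real_derivative
        g' (r * cos t + r * sin t * x) * (- r * sin t + r * cos t * x)) (at t)" for t x
      by (rule DERIV_chain2[OF g_deriv]) (auto intro!: derivative_eq_intros)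
    show "\<bar>g' (r * cos t + r * sin t * x) * (- r * sin t + r * cos t * x)\<bar> \<le> 2 * (r + r * \<bar>x\<bar>)" for t x
    proof -
      have "\<bar>r * sin t\<bar> \<le> r" "\<bar>r * cos t * x\<bar> \<le> r * \<bar>x\<bar>"
        using \<open>0 < r\<close> abs_sin_le_one[of t] abs_cos_le_one[of t]
        by (auto simp: abs_mult mult.assoc intro!: mult_left_le mult_left_le_one_le)
      then have "\<bar>- r * sin t + r * cos t * x\<bar> \<le> r + r * \<bar>x\<bar>"
        by simp
      with g'_bound show ?thesis
        unfolding abs_mult by (intro mult_mono) auto
    qed
    show "integrable std_normal_distribution (\<lambda>x. 2 * (r + r * \<bar>x\<bar>))"
      using mom by simp
  qed (simp_all add: g_int)
  \<comment> \<open>Only interior angles are needed, where both m and s are positive; the endpoints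
    are reached by continuity of \<open>h\<close>.\<close>
  have h'_neg: "h' \<theta> < 0" if "0 < \<theta>" "\<theta> < pi / 2" for \<theta>
  proof -
    define m where "m = r * cos \<theta>"
    define s where "s = r * sin \<theta>"
    have "0 < m" "0 < s"
      using that \<open>0 < r\<close> by (auto simp: m_def s_def cos_gt_zero sin_gt_zero)
    \<comment> \<open>This is g'(w) / w away from 0. Its value at 0, which is 1 by division by zero,
      is multiplied by a quadratic that vanishes there.\<close>
    define k where "k w = tanh w / w + (1 - (tanh w)\<^sup>2)" for w :: real
    have "(\<integral>x. k (m + s * x) * (m * (m + s * x)\<^sup>2 - (m\<^sup>2 + s\<^sup>2) * (m + s * x)) \<partial>std_normal_distribution) < 0"
    proof (rule integral_decreasing_mult_quadratic_neg)
      show "k \<in> borel_measurable borel"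
        unfolding k_def by measurable
      show "\<bar>k w\<bar> \<le> 2" for w
      proof -
        have "\<bar>tanh w / w\<bar> \<le> 1"
          using abs_tanh_le[of w] by (cases "w = 0") (auto simp: divide_le_eq)
        then show ?thesis
          using tanh_sq[of w] zero_le_power2[of "tanh w"] unfolding k_def by linarith
      qed
      show "k (- w) = k w" for w
        by (simp add: k_def)
      show "k y < k x" if "0 < x" "x < y" for x y
      proof -
        have "(tanh x)\<^sup>2 \<le> (tanh y)\<^sup>2"
          using that by (intro power_mono) auto
        then show ?thesis
          using tanh_over_self_strict_decreasing[OF that] by (simp add: k_def)
      qed
    qed fact+
    also have "(\<integral>x. k (m + s * x) * (m * (m + s * x)\<^sup>2 - (m\<^sup>2 + s\<^sup>2) * (m + s * x)) \<partial>std_normal_distribution)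
        = (\<integral>x. s * (g' (m + s * x) * (- s + m * x)) \<partial>std_normal_distribution)"
    proof (rule Bochner_Integration.integral_cong[OF refl])
      fix x
      have "k w * (m * w\<^sup>2 - (m\<^sup>2 + s\<^sup>2) * w) = g' w * (m * w - (m\<^sup>2 + s\<^sup>2))" for w :: real
        by (cases "w = 0") (simp_all add: k_def g'_def field_simps power2_eq_square)
      moreover have "m * (m + s * x) - (m\<^sup>2 + s\<^sup>2) = s * (- s + m * x)"
        by (simp add: algebra_simps power2_eq_square)
      ultimately show "k (m + s * x) * (m * (m + s * x)\<^sup>2 - (m\<^sup>2 + s\<^sup>2) * (m + s * x))
          = s * (g' (m + s * x) * (- s + m * x))"
        by simp
    qed
    finally have "s * h' \<theta> < 0"
      by (simp add: h'_def m_def s_def)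
    then show ?thesis
      using \<open>0 < s\<close> by (simp add: mult_less_0_iff)
  qed
  have "h \<beta> < h \<alpha>"
  proof (rule DERIV_neg_imp_decreasing_open[OF \<open>\<alpha> < \<beta>\<close>])
    show "\<exists>D. (h has_real_derivative D) (at t) \<and> D < 0" if "\<alpha> < t" "t < \<beta>" for t
      using h_deriv[of t] h'_neg[of t] that assms(2,4) by auto
    show "continuous_on {\<alpha>..\<beta>} h"
      using h_deriv by (intro DERIV_continuous_on) (auto intro: has_field_derivative_at_within)
  qed
  then show ?thesis
    by (simp add: h_def)
qed

subsection \<open>Gaussian laws and their projections\<close>

lemma measurable_cosh [measurable]: "(cosh :: real \<Rightarrow> real) \<in> borel_measurable borel"
  by (intro borel_measurable_continuous_onI continuous_intros)

lemma prob_space_std_gaussian: "prob_space (std_gaussian :: (real ^ 'n) measure)"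
proof -
  fix k :: 'n
  interpret prob_space std_normal_distribution
    by (rule prob_space_normal_density) simp
  have "emeasure (std_gaussian :: (real ^ 'n) measure) UNIV
      = emeasure (distr std_gaussian borel (\<lambda>z :: real ^ 'n. z $ k)) UNIV"
    by (subst emeasure_distr) simp_all
  also have "\<dots> = 1"
    using emeasure_space_1 by (simp add: distr_std_gaussian_component)
  finally show ?thesis
    by (intro prob_spaceI) simp
qed

lemma std_gaussian_inner_transfer:
  fixes h :: "real \<Rightarrow> real"
  assumes [measurable]: "h \<in> borel_measurable borel"
  shows "(\<integral>z. h (a \<bullet> z) \<partial>std_gaussian) = (\<integral>x. h (norm a * x) \<partial>std_normal_distribution)"
    and "integrable std_gaussian (\<lambda>z. h (a \<bullet> z)) \<longleftrightarrow>
         integrable std_normal_distribution (\<lambda>x. h (norm a * x))"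
proof -
  have "(\<integral>z. h (a \<bullet> z) \<partial>std_gaussian) = (\<integral>x. h x \<partial>distr std_gaussian borel (\<lambda>z. a \<bullet> z))"
    by (simp add: integral_distr)
  also have "\<dots> = (\<integral>x. h (norm a * x) \<partial>std_normal_distribution)"
    unfolding distr_std_gaussian_inner by (simp add: integral_distr)
  finally show "(\<integral>z. h (a \<bullet> z) \<partial>std_gaussian) = (\<integral>x. h (norm a * x) \<partial>std_normal_distribution)" .
  have "integrable std_gaussian (\<lambda>z. h (a \<bullet> z)) \<longleftrightarrow> integrable (distr std_gaussian borel (\<lambda>z. a \<bullet> z)) h"
    by (simp add: integrable_distr_eq)
  also have "\<dots> \<longleftrightarrow> integrable std_normal_distribution (\<lambda>x. h (norm a * x))"
    unfolding distr_std_gaussian_inner by (simp add: integrable_distr_eq)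
  finally show "integrable std_gaussian (\<lambda>z. h (a \<bullet> z)) \<longleftrightarrow>
         integrable std_normal_distribution (\<lambda>x. h (norm a * x))" .
qed

lemma integrable_std_gaussian_inner: "integrable std_gaussian (\<lambda>z. a \<bullet> z)"
proof -
  have "integrable std_normal_distribution (\<lambda>x. norm a * x)"
    using integrable_std_normal_distribution_moment[of 1] by simp
  then show ?thesis
    using std_gaussian_inner_transfer(2)[of "\<lambda>x. x" a] by simp
qed

lemma integrable_std_gaussian_inner_square: "integrable std_gaussian (\<lambda>z. (a \<bullet> z)\<^sup>2)"
proof -
  have "integrable std_normal_distribution (\<lambda>x. (norm a * x)\<^sup>2)"
    unfolding power_mult_distrib using integrable_std_normal_distribution_moment[of 2] by simp
  then show ?thesis
    using std_gaussian_inner_transfer(2)[of "\<lambda>x. x\<^sup>2" a] by simp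
qed

lemma integral_std_gaussian_inner: "(\<integral>z. a \<bullet> z \<partial>std_gaussian) = 0"
  using std_gaussian_inner_transfer(1)[of "\<lambda>x. x" a] by (simp add: integral_std_normal_distribution_id)

lemma integral_std_gaussian_inner_square: "(\<integral>z. (a \<bullet> z)\<^sup>2 \<partial>std_gaussian) = (norm a)\<^sup>2"
  using std_gaussian_inner_transfer(1)[of "\<lambda>x. x\<^sup>2" a]
  by (simp add: power_mult_distrib integral_std_normal_distribution_square)

text \<open>
  The component of \<open>a\<close> orthogonal to \<open>b\<close> contributes nothing: the reflection along it
  preserves the Gaussian and flips the sign of the integrand. For \<open>b = 0\<close> both sides vanish, by \<open>x / 0 = 0\<close>.
\<close>
lemma integral_std_gaussian_inner_mult:
  fixes h :: "real \<Rightarrow> real" and a b :: "real ^ 'n"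
  assumes [measurable]: "h \<in> borel_measurable borel" and bound: "\<And>x. \<bar>h x\<bar> \<le> C"
  shows "(\<integral>z. (a \<bullet> z) * h (b \<bullet> z) \<partial>std_gaussian)
       = (a \<bullet> b) / norm b * (\<integral>x. x * h (norm b * x) \<partial>std_normal_distribution)"
proof -
  have int: "integrable std_gaussian (\<lambda>z. (v \<bullet> z) * h (b \<bullet> z))" for v
  proof (rule Bochner_Integration.integrable_bound)
    show "integrable std_gaussian (\<lambda>z. C * (v \<bullet> z))"
      by (simp add: integrable_std_gaussian_inner)
    have "\<bar>h x\<bar> \<le> \<bar>C\<bar>" for x
      using bound[of x] by simp
    then show "AE z in std_gaussian. norm ((v \<bullet> z) * h (b \<bullet> z)) \<le> norm (C * (v \<bullet> z))"
      by (auto simp: abs_mult mult.commute[of "\<bar>C\<bar>"] intro!: mult_left_mono)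
  qed measurable
  define c where "c = (a \<bullet> b) / (b \<bullet> b)"
  define u where "u = a - c *\<^sub>R b"
  have "u \<bullet> b = 0"
    by (cases "b = 0") (simp_all add: u_def c_def inner_diff_left)
  have R: "orthogonal_transformation (reflection u)"
    by (rule orthogonal_transformation_reflection)
  then have [measurable]: "reflection u \<in> borel_measurable borel"
    by (simp add: borel_measurable_continuous_onI linear_continuous_on linear_linear
      orthogonal_transformation_linear)
  have "u \<bullet> reflection u z = - (u \<bullet> z)" for z
    by (cases "u = 0") (simp_all add: reflection_def inner_diff_right)
  moreover have "b \<bullet> reflection u z = b \<bullet> z" for z
    using \<open>u \<bullet> b = 0\<close> by (simp add: reflection_def inner_diff_right inner_commute)
  ultimately have "(\<integral>z. (u \<bullet> z) * h (b \<bullet> z) \<partial>distr std_gaussian borel (reflection u))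
      = - (\<integral>z. (u \<bullet> z) * h (b \<bullet> z) \<partial>std_gaussian)"
    by (subst integral_distr) simp_all
  then have "(\<integral>z. (u \<bullet> z) * h (b \<bullet> z) \<partial>std_gaussian) = 0"
    by (simp add: distr_std_gaussian_orthogonal_transformation[OF R])
  moreover have "(a \<bullet> z) * h (b \<bullet> z) = (u \<bullet> z) * h (b \<bullet> z) + c * ((b \<bullet> z) * h (b \<bullet> z))" for z
    by (simp add: u_def inner_diff_left algebra_simps)
  ultimately have "(\<integral>z. (a \<bullet> z) * h (b \<bullet> z) \<partial>std_gaussian) = c * (\<integral>z. (b \<bullet> z) * h (b \<bullet> z) \<partial>std_gaussian)"
    using int by simp
  also have "(\<integral>z. (b \<bullet> z) * h (b \<bullet> z) \<partial>std_gaussian) = norm b * (\<integral>x. x * h (norm b * x) \<partial>std_normal_distribution)"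
    by (subst std_gaussian_inner_transfer(1)[where h = "\<lambda>x. x * h x"]) (simp_all add: mult.assoc)
  also have "c * (norm b * (\<integral>x. x * h (norm b * x) \<partial>std_normal_distribution))
      = (a \<bullet> b) / norm b * (\<integral>x. x * h (norm b * x) \<partial>std_normal_distribution)"
    by (simp add: c_def power2_norm_eq_inner[symmetric] power2_eq_square)
  finally show ?thesis .
qed

text \<open>The functional counterpart of the relation \<open>gaussian_law\<close>: indexing by a
  factor of the covariance gives an actual measure and covers singular covariances.\<close>

definition affine_gaussian :: "real ^ 'n \<Rightarrow> real ^ 'n ^ 'n \<Rightarrow> (real ^ 'n) measure" where
  "affine_gaussian \<mu> \<Lambda> = distr std_gaussian borel (\<lambda>z. \<Lambda> *v z + \<mu>)"

lemma sets_affine_gaussian [simp, measurable_cong]: "sets (affine_gaussian \<mu> \<Lambda>) = sets borel"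
  and space_affine_gaussian [simp]: "space (affine_gaussian \<mu> \<Lambda>) = UNIV"
  by (simp_all add: affine_gaussian_def)

lemma prob_space_affine_gaussian: "prob_space (affine_gaussian \<mu> \<Lambda>)"
  unfolding affine_gaussian_def by (rule prob_space.prob_space_distr[OF prob_space_std_gaussian]) measurable

lemma distr_affine_gaussian_uminus: "distr (affine_gaussian \<mu> \<Lambda>) borel uminus = affine_gaussian (- \<mu>) \<Lambda>"
proof -
  have neg: "distr std_gaussian borel uminus = (std_gaussian :: (real ^ 'n) measure)"
    by (intro distr_std_gaussian_orthogonal_transformation)
      (simp add: orthogonal_transformation_neg[of "\<lambda>x. x", simplified])
  have "affine_gaussian (- \<mu>) \<Lambda> = distr (distr std_gaussian borel uminus) borel (\<lambda>z. \<Lambda> *v z + (- \<mu>))"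
    by (simp add: affine_gaussian_def neg)
  also have "\<dots> = distr (affine_gaussian \<mu> \<Lambda>) borel uminus"
    by (simp add: affine_gaussian_def distr_distr comp_def linear_neg)
  finally show ?thesis by simp
qed

lemma inner_affine: "v \<bullet> (\<Lambda> *v z + \<mu>) = v \<bullet> \<mu> + (v v* \<Lambda>) \<bullet> z" for \<Lambda> :: "real ^ 'n ^ 'n"
  by (simp add: inner_add_right dot_lmul_matrix)

lemma integrable_affine_gaussian_inner: "integrable (affine_gaussian \<mu> \<Lambda>) (\<lambda>x. v \<bullet> x)"
proof -
  interpret prob_space "std_gaussian :: (real ^ 'a) measure"
    by (rule prob_space_std_gaussian)
  show ?thesis
    unfolding affine_gaussian_def
    by (subst integrable_distr_eq) (simp_all add: inner_affine integrable_std_gaussian_inner)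
qed

lemma integral_affine_gaussian_inner_square:
  "(\<integral>x. (v \<bullet> x)\<^sup>2 \<partial>affine_gaussian \<mu> \<Lambda>) = (v \<bullet> \<mu>)\<^sup>2 + (norm (v v* \<Lambda>))\<^sup>2"
proof -
  interpret prob_space "std_gaussian :: (real ^ 'a) measure"
    by (rule prob_space_std_gaussian)
  have "(\<integral>x. (v \<bullet> x)\<^sup>2 \<partial>affine_gaussian \<mu> \<Lambda>)
      = (\<integral>z. (v \<bullet> \<mu> + (v v* \<Lambda>) \<bullet> z)\<^sup>2 \<partial>std_gaussian)"
    unfolding affine_gaussian_def by (subst integral_distr) (simp_all add: inner_affine)
  also have "\<dots> = (\<integral>z. (v \<bullet> \<mu>)\<^sup>2 + 2 * (v \<bullet> \<mu>) * ((v v* \<Lambda>) \<bullet> z) + ((v v* \<Lambda>) \<bullet> z)\<^sup>2 \<partial>std_gaussian)"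
    by (rule Bochner_Integration.integral_cong) (simp_all add: power2_sum)
  also have "\<dots> = (v \<bullet> \<mu>)\<^sup>2 + (norm (v v* \<Lambda>))\<^sup>2"
    using prob_space
    by (simp add: integrable_std_gaussian_inner integrable_std_gaussian_inner_square
        integral_std_gaussian_inner integral_std_gaussian_inner_square)
  finally show ?thesis .
qed

lemma integrable_std_normal_tanh:
  shows "integrable std_normal_distribution (\<lambda>x. tanh (m + s * x))"
    and "integrable std_normal_distribution (\<lambda>x. x * tanh (m + s * x))"
  using integrable_std_normal_distribution_bounded_mult_power[of "\<lambda>x. tanh (m + s * x)" 1 0]
    integrable_std_normal_distribution_bounded_mult_power[of "\<lambda>x. tanh (m + s * x)" 1 1]
  by (simp_all add: abs_tanh_le_1 mult.commute)

text \<open>Split \<open>v \<bullet> x\<close> into its mean and its noise. Only the part of the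
  noise correlated with \<open>d \<bullet> x\<close> survives, and
  \<open>(v v* \<Lambda>) \<bullet> (d v* \<Lambda>)\<close> is that covariance. For s = 0 the
  second term is 0 by division by zero, as it should be.\<close>

lemma integral_affine_gaussian_inner_mult_tanh:
  fixes d v \<mu> :: "real ^ 'n" and \<Lambda> :: "real ^ 'n ^ 'n"
  defines "m \<equiv> d \<bullet> \<mu>" and "s \<equiv> norm (d v* \<Lambda>)"
  shows "(\<integral>x. (v \<bullet> x) * tanh (d \<bullet> x) \<partial>affine_gaussian \<mu> \<Lambda>)
       = (v \<bullet> \<mu>) * (\<integral>x. tanh (m + s * x) \<partial>std_normal_distribution)
         + ((v v* \<Lambda>) \<bullet> (d v* \<Lambda>)) / s * (\<integral>x. x * tanh (m + s * x) \<partial>std_normal_distribution)"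
proof -
  let ?a = "v v* \<Lambda>" and ?b = "d v* \<Lambda>"
  have int1: "integrable std_gaussian (\<lambda>z. tanh (m + ?b \<bullet> z))"
    by (subst std_gaussian_inner_transfer(2)[where h = "\<lambda>x. tanh (m + x)"])
      (simp_all add: integrable_std_normal_tanh)
  have int2: "integrable std_gaussian (\<lambda>z. (?a \<bullet> z) * tanh (m + ?b \<bullet> z))"
    by (rule Bochner_Integration.integrable_bound[OF integrable_std_gaussian_inner[of ?a]])
      (auto simp: abs_mult abs_tanh_le_1 intro!: mult_left_le)
  have "(\<integral>x. (v \<bullet> x) * tanh (d \<bullet> x) \<partial>affine_gaussian \<mu> \<Lambda>)
      = (\<integral>z. (v \<bullet> \<mu>) * tanh (m + ?b \<bullet> z) + (?a \<bullet> z) * tanh (m + ?b \<bullet> z) \<partial>std_gaussian)"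
    unfolding affine_gaussian_def by (subst integral_distr) (simp_all add: inner_affine m_def distrib_right)
  also have "\<dots> = (v \<bullet> \<mu>) * (\<integral>z. tanh (m + ?b \<bullet> z) \<partial>std_gaussian)
      + (\<integral>z. (?a \<bullet> z) * tanh (m + ?b \<bullet> z) \<partial>std_gaussian)"
    using int1 int2 by simp
  also have "(\<integral>z. tanh (m + ?b \<bullet> z) \<partial>std_gaussian) = (\<integral>x. tanh (m + s * x) \<partial>std_normal_distribution)"
    by (subst std_gaussian_inner_transfer(1)[where h = "\<lambda>x. tanh (m + x)"]) (simp_all add: s_def)
  also have "(\<integral>z. (?a \<bullet> z) * tanh (m + ?b \<bullet> z) \<partial>std_gaussian)
      = (?a \<bullet> ?b) / s * (\<integral>x. x * tanh (m + s * x) \<partial>std_normal_distribution)"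
    unfolding s_def
    by (rule integral_std_gaussian_inner_mult[where h = "\<lambda>x. tanh (m + x)" and C = 1])
      (simp_all add: abs_tanh_le_1)
  finally show ?thesis .
qed

lemma integral_affine_gaussian_self_mult_tanh:
  "(\<integral>x. (d \<bullet> x) * tanh (d \<bullet> x) \<partial>affine_gaussian \<mu> \<Lambda>)
     = (\<integral>x. (d \<bullet> \<mu> + norm (d v* \<Lambda>) * x) * tanh (d \<bullet> \<mu> + norm (d v* \<Lambda>) * x) \<partial>std_normal_distribution)"
proof -
  have "(\<integral>x. (d \<bullet> x) * tanh (d \<bullet> x) \<partial>affine_gaussian \<mu> \<Lambda>)
      = (\<integral>z. (d \<bullet> \<mu> + (d v* \<Lambda>) \<bullet> z) * tanh (d \<bullet> \<mu> + (d v* \<Lambda>) \<bullet> z) \<partial>std_gaussian)"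
    unfolding affine_gaussian_def by (subst integral_distr) (simp_all add: inner_affine)
  also have "\<dots> = (\<integral>x. (d \<bullet> \<mu> + norm (d v* \<Lambda>) * x) * tanh (d \<bullet> \<mu> + norm (d v* \<Lambda>) * x) \<partial>std_normal_distribution)"
    by (subst std_gaussian_inner_transfer(1)[where h = "\<lambda>x. (d \<bullet> \<mu> + x) * tanh (d \<bullet> \<mu> + x)"]) simp_all
  finally show ?thesis .
qed

section \<open>Identifying the parameters from second moments and tanh moments\<close>

lemma integral_affine_gaussian_even:
  fixes f :: "real ^ 'n \<Rightarrow> real"
  assumes [measurable]: "f \<in> borel_measurable borel" and "\<And>x. f (- x) = f x"
  shows "(\<integral>x. f x \<partial>affine_gaussian (- \<mu>) \<Lambda>) = (\<integral>x. f x \<partial>affine_gaussian \<mu> \<Lambda>)"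
  unfolding distr_affine_gaussian_uminus[symmetric] by (subst integral_distr) (simp_all add: assms(2))

text \<open>Both pairs lie on one circle in the closed first quadrant, so each is given by an angle
  in [0, pi/2]; strict monotonicity in that angle forces the angles to agree.\<close>

lemma normal_mean_std_unique:
  fixes m s m' s' :: real
  assumes "0 < m" "0 \<le> m'" "0 \<le> s" "0 \<le> s'" and sq: "m\<^sup>2 + s\<^sup>2 = m'\<^sup>2 + s'\<^sup>2"
    and eq: "(\<integral>x. (m + s * x) * tanh (m + s * x) \<partial>std_normal_distribution)
           = (\<integral>x. (m' + s' * x) * tanh (m' + s' * x) \<partial>std_normal_distribution)"
  shows "m = m' \<and> s = s'"
proof -
  define r where "r = sqrt (m\<^sup>2 + s\<^sup>2)"
  have "0 < r"
    using \<open>0 < m\<close> by (simp add: r_def add_pos_nonneg)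
  have r2: "r\<^sup>2 = m\<^sup>2 + s\<^sup>2"
    by (simp add: r_def)
  have polar: "\<exists>\<theta>\<ge>0. \<theta> \<le> pi / 2 \<and> x = r * cos \<theta> \<and> y = r * sin \<theta>"
    if xy: "0 \<le> x" "0 \<le> y" "x\<^sup>2 + y\<^sup>2 = r\<^sup>2" for x y
  proof -
    have "(x / r)\<^sup>2 + (y / r)\<^sup>2 = 1"
      using xy(3) \<open>0 < r\<close> by (simp add: power_divide add_divide_distrib[symmetric])
    then obtain \<theta> where "0 \<le> \<theta>" "\<theta> \<le> pi / 2" "x / r = cos \<theta>" "y / r = sin \<theta>"
      using sincos_total_pi_half[of "x / r" "y / r"] xy \<open>0 < r\<close>
      by (metis divide_nonneg_pos)
    then show ?thesis
      using \<open>0 < r\<close> by (intro exI[of _ \<theta>]) (simp add: field_simps)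
  qed
  obtain \<alpha> where \<alpha>: "0 \<le> \<alpha>" "\<alpha> \<le> pi / 2" "m = r * cos \<alpha>" "s = r * sin \<alpha>"
    using polar[of m s] assms r2 by auto
  obtain \<beta> where \<beta>: "0 \<le> \<beta>" "\<beta> \<le> pi / 2" "m' = r * cos \<beta>" "s' = r * sin \<beta>"
    using polar[of m' s'] assms r2 by auto
  have "\<alpha> = \<beta>"
    using integral_mult_tanh_normal_strict_decreasing[OF \<open>0 < r\<close>, of \<alpha> \<beta>]
      integral_mult_tanh_normal_strict_decreasing[OF \<open>0 < r\<close>, of \<beta> \<alpha>] eq \<alpha> \<beta>
    by (cases \<alpha> \<beta> rule: linorder_cases) simp_all
  then show ?thesis
    using \<alpha> \<beta> by simp
qed

lemma affine_gaussian_parameters_unique_pos: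
  fixes d \<mu> \<mu>' :: "real ^ 'n" and \<Lambda> \<Lambda>' :: "real ^ 'n ^ 'n"
  assumes "0 < d \<bullet> \<mu>" "0 \<le> d \<bullet> \<mu>'"
    and sq: "\<And>v. (\<integral>x. (v \<bullet> x)\<^sup>2 \<partial>affine_gaussian \<mu> \<Lambda>) = (\<integral>x. (v \<bullet> x)\<^sup>2 \<partial>affine_gaussian \<mu>' \<Lambda>')"
    and th: "\<And>v. (\<integral>x. (v \<bullet> x) * tanh (d \<bullet> x) \<partial>affine_gaussian \<mu> \<Lambda>)
                = (\<integral>x. (v \<bullet> x) * tanh (d \<bullet> x) \<partial>affine_gaussian \<mu>' \<Lambda>')"
  shows "\<mu> = \<mu>' \<and> \<Lambda> ** transpose \<Lambda> = \<Lambda>' ** transpose \<Lambda>'"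
proof -
  define m where "m = d \<bullet> \<mu>"
  define s where "s = norm (d v* \<Lambda>)"
  have sq': "(v \<bullet> \<mu>)\<^sup>2 + (norm (v v* \<Lambda>))\<^sup>2 = (v \<bullet> \<mu>')\<^sup>2 + (norm (v v* \<Lambda>'))\<^sup>2" for v
    using sq[of v] by (simp add: integral_affine_gaussian_inner_square)
  have "m = d \<bullet> \<mu>' \<and> s = norm (d v* \<Lambda>')"
    using assms(1,2) sq'[of d] th[of d] unfolding m_def s_def integral_affine_gaussian_self_mult_tanh
    by (intro normal_mean_std_unique) auto
  then have m: "m = d \<bullet> \<mu>'" and s: "s = norm (d v* \<Lambda>')"
    by auto
  \<comment> \<open>Polarization: equality of the quadratic forms yields equality of the bilinear
    second moments.\<close>
  have polar: "(u \<bullet> \<mu>) * (v \<bullet> \<mu>) + (u v* \<Lambda>) \<bullet> (v v* \<Lambda>) = (u \<bullet> \<mu>') * (v \<bullet> \<mu>') + (u v* \<Lambda>') \<bullet> (v v* \<Lambda>')" for u v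
    using sq'[of "u + v"] sq'[of u] sq'[of v]
    by (simp add: inner_add_left vector_matrix_left_distrib power2_norm_eq_inner inner_add_right
        inner_commute power2_sum)
  define P where "P = (\<integral>x. tanh (m + s * x) \<partial>std_normal_distribution)"
  define Q where "Q = (\<integral>x. x * tanh (m + s * x) \<partial>std_normal_distribution)"
  \<comment> \<open>The slope of the tanh moment as a function of the mean. For s = 0 the quotient
    is 0 and the slope is tanh m.\<close>
  have PQ: "P - m * Q / s \<noteq> 0"
  proof (cases "s = 0")
    case True
    interpret prob_space std_normal_distribution
      by (rule prob_space_normal_density) simp
    have "P = tanh m"
      using prob_space by (simp add: P_def True)
    then show ?thesis
      using assms(1) by (simp add: True m_def)
  next
    case False
    then have "0 < s" by (simp add: s_def)
    have "0 < (\<integral>x. (s - m * x) * tanh (m + s * x) \<partial>std_normal_distribution)"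
      using assms(1) \<open>0 < s\<close> by (intro integral_tanh_normal_pos) (simp_all add: m_def)
    also have "\<dots> = (\<integral>x. s * tanh (m + s * x) - m * (x * tanh (m + s * x)) \<partial>std_normal_distribution)"
      by (simp add: left_diff_distrib mult.assoc)
    also have "\<dots> = s * P - m * Q"
      using integrable_std_normal_tanh by (simp add: P_def Q_def)
    finally have "0 < (s * P - m * Q) / s"
      using \<open>0 < s\<close> by simp
    then show ?thesis
      using \<open>0 < s\<close> by (simp add: diff_divide_distrib)
  qed
  have "v \<bullet> (\<mu> - \<mu>') = 0" for v
  proof -
    have "(v \<bullet> \<mu>) * P + ((v v* \<Lambda>) \<bullet> (d v* \<Lambda>)) / s * Q = (v \<bullet> \<mu>') * P + ((v v* \<Lambda>') \<bullet> (d v* \<Lambda>')) / s * Q"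
      using th[of v] m s by (simp add: integral_affine_gaussian_inner_mult_tanh P_def Q_def m_def s_def)
    \<comment> \<open>With \<open>d \<bullet> \<mu>\<close> and \<open>d \<bullet> \<mu>'\<close>
      already equal, a change of mean is compensated in the covariance with \<open>d\<close>; this
      eliminates the covariance from the tanh identity.\<close>
    moreover have "(v v* \<Lambda>') \<bullet> (d v* \<Lambda>') = (v v* \<Lambda>) \<bullet> (d v* \<Lambda>) + (v \<bullet> (\<mu> - \<mu>')) * m"
      using polar[of v d] m by (simp add: m_def inner_diff_right algebra_simps)
    ultimately have "(v \<bullet> (\<mu> - \<mu>')) * (P - m * Q / s) = 0"
      by (simp add: inner_diff_right algebra_simps add_divide_distrib diff_divide_distrib)
    with PQ show ?thesis by simp
  qed
  from this[of "\<mu> - \<mu>'"] have "\<mu> = \<mu>'"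
    by simp
  \<comment> \<open>Unit vectors turn the polarized identity, once the means agree, into equality of
    the Gram matrices of the rows, that is, of the covariances.\<close>
  have row: "axis i 1 v* A = A $ i" for A :: "real ^ 'n ^ 'n" and i
    by (simp add: vector_matrix_mult_def axis_def vec_eq_iff if_distrib if_distribR cong: if_cong)
  have "\<Lambda> $ i \<bullet> \<Lambda> $ j = \<Lambda>' $ i \<bullet> \<Lambda>' $ j" for i j
    using polar[of "axis i 1" "axis j 1"] \<open>\<mu> = \<mu>'\<close> by (simp add: row)
  then have "\<Lambda> ** transpose \<Lambda> = \<Lambda>' ** transpose \<Lambda>'"
    by (simp add: vec_eq_iff matrix_matrix_mult_def transpose_def inner_vec_def)
  with \<open>\<mu> = \<mu>'\<close> show ?thesis by simp
qed

text \<open>Both test functions are even, so either mean may be negated without changing the data;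
  the signs are chosen to reach the previous lemma.\<close>

lemma affine_gaussian_parameters_unique:
  fixes d \<mu> \<mu>' :: "real ^ 'n" and \<Lambda> \<Lambda>' :: "real ^ 'n ^ 'n"
  assumes "d \<bullet> \<mu> \<noteq> 0"
    and sq: "\<And>v. (\<integral>x. (v \<bullet> x)\<^sup>2 \<partial>affine_gaussian \<mu> \<Lambda>) = (\<integral>x. (v \<bullet> x)\<^sup>2 \<partial>affine_gaussian \<mu>' \<Lambda>')"
    and th: "\<And>v. (\<integral>x. (v \<bullet> x) * tanh (d \<bullet> x) \<partial>affine_gaussian \<mu> \<Lambda>)
                = (\<integral>x. (v \<bullet> x) * tanh (d \<bullet> x) \<partial>affine_gaussian \<mu>' \<Lambda>')"
  shows "\<mu>' \<in> {\<mu>, - \<mu>} \<and> \<Lambda> ** transpose \<Lambda> = \<Lambda>' ** transpose \<Lambda>'"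
proof -
  have sq_neg: "(\<integral>x. (v \<bullet> x)\<^sup>2 \<partial>affine_gaussian (- \<nu>) L) = (\<integral>x. (v \<bullet> x)\<^sup>2 \<partial>affine_gaussian \<nu> L)"
    for v \<nu> :: "real ^ 'n" and L
    by (rule integral_affine_gaussian_even) simp_all
  have th_neg: "(\<integral>x. (v \<bullet> x) * tanh (d \<bullet> x) \<partial>affine_gaussian (- \<nu>) L)
      = (\<integral>x. (v \<bullet> x) * tanh (d \<bullet> x) \<partial>affine_gaussian \<nu> L)" for v \<nu> :: "real ^ 'n" and L
    by (rule integral_affine_gaussian_even) simp_all
  define \<nu> where "\<nu> = (if 0 < d \<bullet> \<mu> then \<mu> else - \<mu>)"
  define \<nu>' where "\<nu>' = (if 0 \<le> d \<bullet> \<mu>' then \<mu>' else - \<mu>')"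
  have "\<nu> = \<nu>' \<and> \<Lambda> ** transpose \<Lambda> = \<Lambda>' ** transpose \<Lambda>'"
  proof (rule affine_gaussian_parameters_unique_pos)
    show "0 < d \<bullet> \<nu>" "0 \<le> d \<bullet> \<nu>'"
      using assms(1) by (auto simp: \<nu>_def \<nu>'_def)
    show "(\<integral>x. (v \<bullet> x)\<^sup>2 \<partial>affine_gaussian \<nu> \<Lambda>) = (\<integral>x. (v \<bullet> x)\<^sup>2 \<partial>affine_gaussian \<nu>' \<Lambda>')" for v
      using sq[of v] by (simp add: \<nu>_def \<nu>'_def sq_neg)
    show "(\<integral>x. (v \<bullet> x) * tanh (d \<bullet> x) \<partial>affine_gaussian \<nu> \<Lambda>)
        = (\<integral>x. (v \<bullet> x) * tanh (d \<bullet> x) \<partial>affine_gaussian \<nu>' \<Lambda>')" for v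
      using th[of v] by (simp add: \<nu>_def \<nu>'_def th_neg)
  qed
  then show ?thesis
    by (auto simp: \<nu>_def \<nu>'_def split: if_splits)
qed

subsection \<open>The minimax problem\<close>

lemma gaussian_law_iff: "gaussian_law N \<mu> (\<Lambda> ** transpose \<Lambda>) \<longleftrightarrow> N = affine_gaussian \<mu> \<Lambda>"
  unfolding gaussian_law_def affine_gaussian_def using distr_std_gaussian_cov_unique by metis

lemma symmetric_mixture_law_iff:
  "symmetric_mixture_law P \<mu> (\<Lambda> ** transpose \<Lambda>) \<longleftrightarrow> sets P = sets borel \<and>
     (\<forall>B\<in>sets borel. measure P B =
        1/2 * measure (affine_gaussian \<mu> \<Lambda>) B + 1/2 * measure (affine_gaussian (- \<mu>) \<Lambda>) B)"
  by (simp add: symmetric_mixture_law_def gaussian_law_iff)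

lemma symmetric_mixture_law_uminus:
  fixes \<Lambda> :: "real ^ 'n ^ 'n"
  shows "symmetric_mixture_law P (- \<mu>) (\<Lambda> ** transpose \<Lambda>) \<longleftrightarrow> symmetric_mixture_law P \<mu> (\<Lambda> ** transpose \<Lambda>)"
  by (simp add: symmetric_mixture_law_iff add.commute)

lemma symmetric_mixture_law_unique:
  fixes \<Lambda> :: "real ^ 'n ^ 'n"
  assumes "symmetric_mixture_law P \<mu> (\<Lambda> ** transpose \<Lambda>)" "symmetric_mixture_law Q \<mu> (\<Lambda> ** transpose \<Lambda>)"
    and "finite_measure P" "finite_measure Q"
  shows "P = Q"
  using assms by (intro measure_eqI) (simp_all add: symmetric_mixture_law_iff finite_measure.emeasure_eq_measure)

text \<open>An even function cannot distinguish the two mirror-image components, so its image law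
  under the mixture is the one under a single component; equal image laws give equal
  integrals.\<close>

lemma integral_symmetric_mixture_even:
  fixes f :: "real ^ 'n \<Rightarrow> real"
  assumes P: "symmetric_mixture_law P \<mu> (\<Lambda> ** transpose \<Lambda>)" and "finite_measure P"
    and f [measurable]: "f \<in> borel_measurable borel" and even: "\<And>x. f (- x) = f x"
  shows "(\<integral>x. f x \<partial>P) = (\<integral>x. f x \<partial>affine_gaussian \<mu> \<Lambda>)"
proof -
  have [measurable_cong]: "sets P = sets borel"
    using P by (simp add: symmetric_mixture_law_iff)
  then have [simp]: "space P = UNIV"
    using sets_eq_imp_space_eq[of P borel] by simp
  interpret P: finite_measure P by fact
  interpret N: prob_space "affine_gaussian \<mu> \<Lambda>" by (rule prob_space_affine_gaussian)
  have "distr P borel f = distr (affine_gaussian \<mu> \<Lambda>) borel f"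
  proof (rule measure_eqI)
    fix B assume "B \<in> sets (distr P borel f)"
    then have [measurable]: "B \<in> sets borel" by simp
    have fB: "f -` B \<in> sets borel"
      using measurable_sets_borel[OF f] by simp
    have "measure (affine_gaussian (- \<mu>) \<Lambda>) (f -` B) = measure (affine_gaussian \<mu> \<Lambda>) (uminus -` (f -` B))"
      using fB by (simp add: distr_affine_gaussian_uminus[symmetric] measure_distr)
    also have "uminus -` (f -` B) = f -` B"
      by (auto simp: even)
    finally have "measure P (f -` B) = measure (affine_gaussian \<mu> \<Lambda>) (f -` B)"
      using P fB by (simp add: symmetric_mixture_law_iff)
    then show "emeasure (distr P borel f) B = emeasure (distr (affine_gaussian \<mu> \<Lambda>) borel f) B"
      by (simp add: emeasure_distr P.emeasure_eq_measure N.emeasure_eq_measure)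
  qed simp
  then have "(\<integral>x. x \<partial>distr P borel f) = (\<integral>x. x \<partial>distr (affine_gaussian \<mu> \<Lambda>) borel f)"
    by simp
  then show ?thesis
    by (simp add: integral_distr)
qed

text \<open>Split on the sign Y. Independence gives each branch weight 1/2, and on Y = -1 the output
  lies in \<open>B\<close> exactly when the affine image lies in the reflected set, which produces
  the component with mean \<open>- \<mu>\<close>.\<close>

lemma symmetric_mixture_law_generator:
  fixes Z :: "'a \<Rightarrow> real ^ 'n" and Y :: "'a \<Rightarrow> real"
  assumes "prob_space M"
    and [measurable]: "Y \<in> borel_measurable M"
    and Y1: "measure M {\<omega> \<in> space M. Y \<omega> = 1} = 1/2"
    and Y2: "measure M {\<omega> \<in> space M. Y \<omega> = -1} = 1/2"
    and [measurable]: "Z \<in> borel_measurable M"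
    and Z: "distr M borel Z = std_gaussian"
    and indep: "prob_space.indep_set M {Y -` B \<inter> space M | B. B \<in> sets borel}
                                {Z -` B \<inter> space M | B. B \<in> sets borel}"
  shows "symmetric_mixture_law (distr M borel (\<lambda>\<omega>. generator \<Lambda> \<mu> (Y \<omega>) (Z \<omega>))) \<mu> (\<Lambda> ** transpose \<Lambda>)"
    and "(\<lambda>\<omega>. generator \<Lambda> \<mu> (Y \<omega>) (Z \<omega>)) \<in> borel_measurable M"
proof -
  interpret prob_space M by fact
  show meas [measurable]: "(\<lambda>\<omega>. generator \<Lambda> \<mu> (Y \<omega>) (Z \<omega>)) \<in> borel_measurable M"
    unfolding generator_def by measurable
  have branch: "prob {\<omega> \<in> space M. Y \<omega> = y \<and> \<Lambda> *v Z \<omega> + \<mu> \<in> C} = 1/2 * measure (affine_gaussian \<mu> \<Lambda>) C"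
    if "prob {\<omega> \<in> space M. Y \<omega> = y} = 1/2" and [measurable]: "C \<in> sets borel" for y C
  proof -
    let ?C = "{z. \<Lambda> *v z + \<mu> \<in> C}"
    have C [measurable]: "?C \<in> sets borel" by measurable
    have "{\<omega> \<in> space M. Y \<omega> = y \<and> \<Lambda> *v Z \<omega> + \<mu> \<in> C} = (Y -` {y} \<inter> space M) \<inter> (Z -` ?C \<inter> space M)"
      by auto
    also have "prob \<dots> = prob (Y -` {y} \<inter> space M) * prob (Z -` ?C \<inter> space M)"
    proof (rule indep_setD[OF indep])
      show "Y -` {y} \<inter> space M \<in> {Y -` B \<inter> space M | B. B \<in> sets borel}"
        by (intro CollectI exI[of _ "{y}"]) simp
      show "Z -` ?C \<inter> space M \<in> {Z -` B \<inter> space M | B. B \<in> sets borel}"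
        using C by (intro CollectI exI[of _ ?C]) simp
    qed
    also have "prob (Y -` {y} \<inter> space M) = 1/2"
      using that(1) by (simp add: vimage_def Int_def conj_commute)
    also have "prob (Z -` ?C \<inter> space M) = measure std_gaussian ?C"
      unfolding Z[symmetric] by (simp add: measure_distr)
    also have "\<dots> = measure (affine_gaussian \<mu> \<Lambda>) C"
      by (simp add: affine_gaussian_def measure_distr vimage_def)
    finally show ?thesis .
  qed
  \<comment> \<open>The two disjoint events have total probability 1, so all other values of Y are
    negligible.\<close>
  have "prob {\<omega> \<in> space M. Y \<omega> = 1 \<or> Y \<omega> = -1} = prob {\<omega> \<in> space M. Y \<omega> = 1} + prob {\<omega> \<in> space M. Y \<omega> = -1}"
    by (subst finite_measure_Union[symmetric]) (auto intro!: arg_cong[where f = prob])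
  then have AE_Y: "AE \<omega> in M. Y \<omega> = 1 \<or> Y \<omega> = -1"
    using Y1 Y2 by (intro AE_I_eq_1) (simp_all add: emeasure_eq_measure)
  show "symmetric_mixture_law (distr M borel (\<lambda>\<omega>. generator \<Lambda> \<mu> (Y \<omega>) (Z \<omega>))) \<mu> (\<Lambda> ** transpose \<Lambda>)"
    unfolding symmetric_mixture_law_iff
  proof (intro conjI ballI)
    fix B :: "(real ^ 'n) set" assume [measurable]: "B \<in> sets borel"
    have B': "uminus -` B \<in> sets borel"
      using measurable_sets_borel[of uminus borel B] by simp
    let ?E1 = "{\<omega> \<in> space M. Y \<omega> = 1 \<and> \<Lambda> *v Z \<omega> + \<mu> \<in> B}"
    let ?E2 = "{\<omega> \<in> space M. Y \<omega> = -1 \<and> \<Lambda> *v Z \<omega> + \<mu> \<in> uminus -` B}"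
    have [measurable]: "?E1 \<in> sets M" "?E2 \<in> sets M"
      using B' by measurable
    have "measure (distr M borel (\<lambda>\<omega>. generator \<Lambda> \<mu> (Y \<omega>) (Z \<omega>))) B
        = prob {\<omega> \<in> space M. generator \<Lambda> \<mu> (Y \<omega>) (Z \<omega>) \<in> B}"
      by (simp add: measure_distr vimage_def Int_def conj_commute)
    also have "\<dots> = prob (?E1 \<union> ?E2)"
      using AE_Y by (intro measure_eq_AE) (auto simp: generator_def elim!: eventually_mono)
    also have "\<dots> = prob ?E1 + prob ?E2"
      by (rule finite_measure_Union) auto
    also have "prob ?E1 = 1/2 * measure (affine_gaussian \<mu> \<Lambda>) B"
      using Y1 by (rule branch) simp
    also have "prob ?E2 = 1/2 * measure (affine_gaussian \<mu> \<Lambda>) (uminus -` B)"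
      using Y2 B' by (rule branch)
    also have "measure (affine_gaussian \<mu> \<Lambda>) (uminus -` B) = measure (affine_gaussian (- \<mu>) \<Lambda>) B"
      by (simp add: distr_affine_gaussian_uminus[symmetric] measure_distr)
    finally show "measure (distr M borel (\<lambda>\<omega>. generator \<Lambda> \<mu> (Y \<omega>) (Z \<omega>))) B
        = 1/2 * measure (affine_gaussian \<mu> \<Lambda>) B + 1/2 * measure (affine_gaussian (- \<mu>) \<Lambda>) B" .
  qed simp
qed

section \<open>Test discriminators and first-order optimality\<close>

lemma measurable_discriminator [measurable]: "discriminator A b1 b2 b3 b4 \<in> borel_measurable borel"
  unfolding discriminator_def by measurable

lemma discriminator_reference: "discriminator 0 d (- d) d (- d) x = 0"
  by (simp add: discriminator_def less_imp_neq[symmetric] add_pos_pos)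

text \<open>At the reference vectors the logarithm vanishes, so a perturbation of A along v v^T
  probes exactly the second moment in direction \<open>v\<close>.\<close>

lemma discriminator_rank_one:
  "discriminator (t *\<^sub>R (\<chi> i j. v $ i * v $ j)) d (- d) d (- d) x = t / 2 * (v \<bullet> x)\<^sup>2"
proof -
  have "(\<chi> i j. v $ i * v $ j) *v x = (v \<bullet> x) *\<^sub>R v"
    by (simp add: vec_eq_iff matrix_vector_mult_def inner_vec_def sum_distrib_left mult_ac)
  then show ?thesis
    by (simp add: discriminator_def scaleR_matrix_vector_assoc[symmetric] power2_eq_square
        inner_commute less_imp_neq[symmetric] add_pos_pos)
qed

lemma discriminator_ln_cosh:
  "discriminator 0 b (- b) d (- d) x = ln (cosh (b \<bullet> x)) - ln (cosh (d \<bullet> x))"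
proof -
  have "exp y + exp (- y) = 2 * cosh y" for y :: real
    by (simp add: cosh_field_def)
  then show ?thesis
    by (simp add: discriminator_def ln_div cosh_real_pos)
qed

lemma abs_ln_cosh_le: "\<bar>ln (cosh y)\<bar> \<le> \<bar>y\<bar>" for y :: real
proof -
  have "cosh y \<le> exp \<bar>y\<bar>"
  proof -
    have "exp y + exp (- y) \<le> exp \<bar>y\<bar> + exp \<bar>y\<bar>"
      by (intro add_mono) simp_all
    then show ?thesis by (simp add: cosh_field_def)
  qed
  then have "ln (cosh y) \<le> \<bar>y\<bar>"
    by (metis cosh_real_pos exp_gt_zero ln_exp ln_le_cancel_iff)
  moreover have "0 \<le> ln (cosh y)"
    using cosh_real_ge_1[of y] by simp
  ultimately show ?thesis by simp
qed

lemma integrable_ln_cosh: "integrable (affine_gaussian \<mu> \<Lambda>) (\<lambda>x. ln (cosh (b \<bullet> x)))"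
  by (rule Bochner_Integration.integrable_bound[OF integrable_affine_gaussian_inner[of _ _ b]])
    (auto simp: abs_ln_cosh_le)

text \<open>The derivative of ln cosh is tanh, bounded by 1, so
  \<open>\<bar>v \<bullet> x\<bar>\<close> dominates uniformly in t.\<close>

lemma has_real_derivative_integral_ln_cosh:
  "((\<lambda>t. \<integral>x. ln (cosh ((d + t *\<^sub>R v) \<bullet> x)) \<partial>affine_gaussian \<mu> \<Lambda>) has_real_derivative
     (\<integral>x. (v \<bullet> x) * tanh (d \<bullet> x) \<partial>affine_gaussian \<mu> \<Lambda>)) (at 0)"
proof -
  have "((\<lambda>t. \<integral>x. ln (cosh ((d + t *\<^sub>R v) \<bullet> x)) \<partial>affine_gaussian \<mu> \<Lambda>) has_real_derivative
     (\<integral>x. (v \<bullet> x) * tanh ((d + 0 *\<^sub>R v) \<bullet> x) \<partial>affine_gaussian \<mu> \<Lambda>)) (at 0)"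
  proof (rule has_real_derivative_lebesgue_integral[where B = "\<lambda>x. \<bar>v \<bullet> x\<bar>"])
    show "((\<lambda>t. ln (cosh ((d + t *\<^sub>R v) \<bullet> x))) has_real_derivative
        (v \<bullet> x) * tanh ((d + t *\<^sub>R v) \<bullet> x)) (at t)" for t x
      unfolding inner_add_left inner_scaleR_left tanh_def
      by (auto intro!: derivative_eq_intros simp: cosh_real_pos)
    show "integrable (affine_gaussian \<mu> \<Lambda>) (\<lambda>x. \<bar>v \<bullet> x\<bar>)"
      using integrable_affine_gaussian_inner by (rule integrable_abs)
  qed (auto simp: integrable_ln_cosh abs_mult abs_tanh_le_1 intro!: mult_left_le)
  then show ?thesis by simp
qed

text \<open>Subtracting the square makes 0 a maximum without changing the derivative there. It
  removes the regularizer, which is quadratic around the reference discriminator.\<close>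

lemma deriv_zero_of_le_square:
  fixes f :: "real \<Rightarrow> real"
  assumes "(f has_real_derivative D) (at 0)" and "\<And>t. f t \<le> f 0 + c * t\<^sup>2"
  shows "D = 0"
proof -
  have "((\<lambda>t. f t - c * t\<^sup>2) has_real_derivative D) (at 0)"
    using assms(1) by (auto intro!: derivative_eq_intros)
  then show ?thesis
    using assms(2) by (intro DERIV_local_max[of "\<lambda>t. f t - c * t\<^sup>2" D 0 1]) (simp_all add: diff_le_eq)
qed

text \<open>The mean is identified up to sign because \<mu> and -\<mu> give the same mixture. The
  proviso \<open>\<mu>\<^sub>X \<bullet> d \<noteq> 0\<close> excludes degenerate cases such as d =
  0, where every parameter pair is separable and the tanh condition is void. Existence of a factor
  of the covariance keeps the minimizer claim from being vacuous.\<close>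

theorem theorem3:
  fixes M :: "'a measure"
    and X Z :: "'a \<Rightarrow> real ^ 'n" and Y :: "'a \<Rightarrow> real"
    and d \<mu>\<^sub>X :: "real ^ 'n" and \<Sigma>\<^sub>X :: "real ^ 'n ^ 'n" and lam :: real
  assumes "prob_space M"
    and "X \<in> borel_measurable M"
    and "symmetric_mixture_law (distr M borel X) \<mu>\<^sub>X \<Sigma>\<^sub>X"
    and "Y \<in> borel_measurable M"
    and "measure M {\<omega> \<in> space M. Y \<omega> = 1} = 1/2"
    and "measure M {\<omega> \<in> space M. Y \<omega> = -1} = 1/2"
    and "Z \<in> borel_measurable M"
    and "distr M borel Z = std_gaussian"
    and "prob_space.indep_set M {Y -` B \<inter> space M | B. B \<in> sets borel}
                                {Z -` B \<inter> space M | B. B \<in> sets borel}"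
    and "lam > 0"
    and "separability d \<mu>\<^sub>X \<Sigma>\<^sub>X"
  shows "(\<exists>\<Lambda> :: real ^ 'n ^ 'n. \<Lambda> ** transpose \<Lambda> = \<Sigma>\<^sub>X) \<and>
    (\<forall>\<Lambda>. \<Lambda> ** transpose \<Lambda> = \<Sigma>\<^sub>X \<longrightarrow>
       (\<forall>\<mu>\<in>{\<mu>\<^sub>X, - \<mu>\<^sub>X}. loss_minimizer M X Y Z lam d \<Lambda> \<mu>)) \<and>
    (\<mu>\<^sub>X \<bullet> d \<noteq> 0 \<longrightarrow>
       (\<forall>\<Lambda> \<mu>. loss_minimizer M X Y Z lam d \<Lambda> \<mu> \<and> separability d \<mu> (\<Lambda> ** transpose \<Lambda>) \<longrightarrow>
          \<mu> \<in> {\<mu>\<^sub>X, - \<mu>\<^sub>X} \<and> \<Lambda> ** transpose \<Lambda> = \<Sigma>\<^sub>X))"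
proof -
  interpret prob_space M by fact
  note [measurable] = assms(2,4,7)
  let ?G = "\<lambda>\<Lambda> \<mu> \<omega>. generator \<Lambda> \<mu> (Y \<omega>) (Z \<omega>)"
  let ?L = "\<lambda>\<Lambda> \<mu>. generator_loss M X Y Z lam d \<Lambda> \<mu>"
  let ?obj = "\<lambda>\<Lambda> \<mu> A b1 b2 b3 b4. minimax_objective M X Y Z lam d \<Lambda> \<mu> A b1 b2 b3 b4"
  note G_law = symmetric_mixture_law_generator(1)[OF assms(1,4-9)]
    and [measurable] = symmetric_mixture_law_generator(2)[OF assms(1,4-9)]
  obtain S :: "real ^ 'n ^ 'n" where S: "S ** transpose S = \<Sigma>\<^sub>X"
    using assms(3) unfolding symmetric_mixture_law_def gaussian_law_def by blast
  have obj_le_L: "ereal (?obj \<Lambda> \<mu> A b1 b2 b3 b4) \<le> ?L \<Lambda> \<mu>" for \<Lambda> \<mu> A b1 b2 b3 b4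
    unfolding generator_loss_def
    by (rule SUP_upper2[of A], simp, rule SUP_upper2[of b1], simp, rule SUP_upper2[of b2], simp,
        rule SUP_upper2[of b3], simp, rule SUP_upper2[of b4]) simp_all
  have L_nonneg: "0 \<le> ?L \<Lambda> \<mu>" for \<Lambda> \<mu>
    using obj_le_L[of \<Lambda> \<mu> 0 d "- d" d "- d"]
    by (simp add: minimax_objective_def discriminator_reference zero_ereal_def[symmetric])
  \<comment> \<open>Equal laws of data and generator cancel the two expectations for every
    discriminator, leaving only minus a nonnegative penalty.\<close>
  have L_true: "?L \<Lambda> \<mu> = 0" if \<Lambda>: "\<Lambda> ** transpose \<Lambda> = \<Sigma>\<^sub>X" and \<mu>: "\<mu> \<in> {\<mu>\<^sub>X, - \<mu>\<^sub>X}" for \<Lambda> \<mu>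
  proof (rule antisym)
    have "symmetric_mixture_law (distr M borel X) \<mu> (\<Lambda> ** transpose \<Lambda>)"
      using assms(3) \<mu> unfolding \<Lambda>[symmetric] by (auto simp: symmetric_mixture_law_uminus)
    then have "distr M borel X = distr M borel (?G \<Lambda> \<mu>)"
      using G_law by (rule symmetric_mixture_law_unique)
        (simp_all add: prob_space.finite_measure prob_space_distr)
    then have "(\<integral>\<omega>. discriminator A b1 b2 b3 b4 (X \<omega>) \<partial>M)
        = (\<integral>\<omega>. discriminator A b1 b2 b3 b4 (?G \<Lambda> \<mu> \<omega>) \<partial>M)" for A b1 b2 b3 b4
      using integral_distr[of X M borel "discriminator A b1 b2 b3 b4"]
        integral_distr[of "?G \<Lambda> \<mu>" M borel "discriminator A b1 b2 b3 b4"] by simp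
    then have "?obj \<Lambda> \<mu> A b1 b2 b3 b4 \<le> 0" for A b1 b2 b3 b4
      using \<open>lam > 0\<close> by (simp add: minimax_objective_def)
    then show "?L \<Lambda> \<mu> \<le> 0"
      unfolding generator_loss_def by (intro SUP_least) simp
  qed (rule L_nonneg)
  have minimizer: "loss_minimizer M X Y Z lam d \<Lambda> \<mu>"
    if "\<Lambda> ** transpose \<Lambda> = \<Sigma>\<^sub>X" "\<mu> \<in> {\<mu>\<^sub>X, - \<mu>\<^sub>X}" for \<Lambda> \<mu>
    using L_nonneg L_true[OF that] by (auto simp: loss_minimizer_def is_arg_min_def not_less)
  have unique: "\<mu> \<in> {\<mu>\<^sub>X, - \<mu>\<^sub>X} \<and> \<Lambda> ** transpose \<Lambda> = \<Sigma>\<^sub>X"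
    if "\<mu>\<^sub>X \<bullet> d \<noteq> 0" and min: "loss_minimizer M X Y Z lam d \<Lambda> \<mu>" for \<Lambda> \<mu>
  proof -
    have "?L \<Lambda> \<mu> \<le> ?L S \<mu>\<^sub>X"
      using min by (auto simp: loss_minimizer_def is_arg_min_def not_less)
    then have "?L \<Lambda> \<mu> \<le> 0"
      by (simp add: L_true[OF S])
    \<comment> \<open>A minimizer does no worse than the true parameters, whose loss is 0. Hence no
      discriminator has positive objective, and the reference one, with value 0, is optimal.\<close>
    then have obj_le: "?obj \<Lambda> \<mu> A b1 b2 b3 b4 \<le> 0" for A b1 b2 b3 b4
      using obj_le_L[of \<Lambda> \<mu> A b1 b2 b3 b4] order_trans by fastforce
    let ?N = "affine_gaussian \<mu>\<^sub>X S" and ?N' = "affine_gaussian \<mu> \<Lambda>"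
    have X_even: "(\<integral>\<omega>. f (X \<omega>) \<partial>M) = (\<integral>x. f x \<partial>?N)"
      if [measurable]: "f \<in> borel_measurable borel" and "\<And>x. f (- x) = f x" for f :: "real ^ 'n \<Rightarrow> real"
      using integral_symmetric_mixture_even[of "distr M borel X" \<mu>\<^sub>X S f] that assms(3)
      by (simp add: S integral_distr prob_space.finite_measure prob_space_distr)
    have G_even: "(\<integral>\<omega>. f (?G \<Lambda> \<mu> \<omega>) \<partial>M) = (\<integral>x. f x \<partial>?N')"
      if [measurable]: "f \<in> borel_measurable borel" and "\<And>x. f (- x) = f x" for f :: "real ^ 'n \<Rightarrow> real"
      using integral_symmetric_mixture_even[of "distr M borel (?G \<Lambda> \<mu>)" \<mu> \<Lambda> f] that G_law
      by (simp add: integral_distr prob_space.finite_measure prob_space_distr)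
    have sq: "(\<integral>x. (v \<bullet> x)\<^sup>2 \<partial>?N) = (\<integral>x. (v \<bullet> x)\<^sup>2 \<partial>?N')" for v
    proof -
      let ?I = "(\<integral>x. (v \<bullet> x)\<^sup>2 \<partial>?N) - (\<integral>x. (v \<bullet> x)\<^sup>2 \<partial>?N')"
      define W where "W = (\<chi> i j. v $ i * v $ j)"
      have "?I / 2 = 0"
      proof (rule deriv_zero_of_le_square)
        show "((\<lambda>t. t * (?I / 2)) has_real_derivative ?I / 2) (at 0)"
          by (auto intro!: derivative_eq_intros)
        \<comment> \<open>The expectations are linear in t, the Frobenius penalty quadratic; the
          zero term is the value at t = 0.\<close>
        show "t * (?I / 2) \<le> 0 * (?I / 2) + lam / 2 * (norm W)\<^sup>2 * t\<^sup>2" for t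
          using obj_le[of "t *\<^sub>R W" d "- d" d "- d"] X_even[of "\<lambda>x. (v \<bullet> x)\<^sup>2"]
            G_even[of "\<lambda>x. (v \<bullet> x)\<^sup>2"]
          by (simp add: minimax_objective_def W_def discriminator_rank_one power_mult_distrib algebra_simps
              diff_divide_distrib)
      qed
      then show ?thesis by simp
    qed
    have th: "(\<integral>x. (v \<bullet> x) * tanh (d \<bullet> x) \<partial>?N) = (\<integral>x. (v \<bullet> x) * tanh (d \<bullet> x) \<partial>?N')" for v
    proof -
      define J where "J t = (\<integral>x. ln (cosh ((d + t *\<^sub>R v) \<bullet> x)) \<partial>?N)
        - (\<integral>x. ln (cosh ((d + t *\<^sub>R v) \<bullet> x)) \<partial>?N')" for t
      have "(\<integral>x. (v \<bullet> x) * tanh (d \<bullet> x) \<partial>?N) - (\<integral>x. (v \<bullet> x) * tanh (d \<bullet> x) \<partial>?N') = 0"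
      proof (rule deriv_zero_of_le_square)
        show "(J has_real_derivative (\<integral>x. (v \<bullet> x) * tanh (d \<bullet> x) \<partial>?N)
            - (\<integral>x. (v \<bullet> x) * tanh (d \<bullet> x) \<partial>?N')) (at 0)"
          unfolding J_def by (intro DERIV_diff has_real_derivative_integral_ln_cosh)
        show "J t \<le> J 0 + lam * (norm v)\<^sup>2 * t\<^sup>2" for t
        proof -
          let ?b = "d + t *\<^sub>R v"
          let ?f = "\<lambda>x. ln (cosh (?b \<bullet> x)) - ln (cosh (d \<bullet> x))"
          have "(\<integral>\<omega>. ?f (X \<omega>) \<partial>M) - (\<integral>\<omega>. ?f (?G \<Lambda> \<mu> \<omega>) \<partial>M) = J t - J 0"
            using X_even[of ?f] G_even[of ?f] by (simp add: J_def integrable_ln_cosh)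
          \<comment> \<open>The offsets of b1 and b2 are t v and -t v; each costs
            \<open>lam / 2 * (norm v)^2 * t^2\<close>.\<close>
          then have "?obj \<Lambda> \<mu> 0 ?b (- ?b) d (- d) = J t - J 0 - lam * (norm v)\<^sup>2 * t\<^sup>2"
            unfolding minimax_objective_def discriminator_ln_cosh by (simp add: power_mult_distrib)
          then show ?thesis
            using obj_le[of 0 ?b "- ?b" d "- d"] by simp
        qed
      qed
      then show ?thesis by simp
    qed
    have "d \<bullet> \<mu>\<^sub>X \<noteq> 0"
      using that(1) by (simp add: inner_commute)
    from affine_gaussian_parameters_unique[OF this sq th] show ?thesis
      by (simp add: S)
  qed
  show ?thesis
    using S minimizer unique by blast
qed

end
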